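(* Let $P$ and $Q$ be origin-symmetric convex polygons in $\mathbb{R}^2$, and let $M$ be a non-trivial analytic origin-symmetric hedgehog contained in the interior of $P$ and in the interior of $Q$. If $$\mathrm{vol}_2(P\cap S_M(\xi))=\mathrm{vol}_2(Q\cap S_M(\xi))\quad\text{for all }\xi\in S^1,$$ where $S_M(\xi)$ is the slab between the two parallel supporting lines of $M$ with normal direction $\xi$, then $P=Q$.
   Context: $S^1$ is the unit circle in $\mathbb{R}^2$, and $\langle\cdot,\cdot\rangle$ is the standard inner product. A convex polygon is a bounded closed polygonal convex region with non-empty interior. A set $K$ is origin-symmetric if $-v\in K$ whenever $v\in K$. $\mathrm{vol}_2$ denotes area. Hedgehogs: given a smooth function $h_M:S^1\to\mathbb{R}$ (the support function), the hedgehog $M$ is the envelope of the family of lines $H_M(\xi)=\{x\in\mathbb{R}^2:\langle x,\xi\rangle=h_M(\xi)\}$, $\xi\in S^1$. Writing $\xi=(\cos\theta,\sin\theta)$ and $h_M(\theta)=h_M(\xi(\theta))$ ($2\pi$-periodic), $$M=\{h_M(\theta)(\cos\theta,\sin\theta)+h_M'(\theta)(-\sin\theta,\cos\theta):\theta\in[0,2\pi]\}.$$ $M$ need not be convex. The lines $H_M(\xi)$ are the supporting lines of $M$. The hedgehog is analytic if $h_M$ is real analytic on $S^1$ (as a function of $\theta$). It is origin-symmetric if it is symmetric about the origin, i.e. $h_M(-\xi)=h_M(\xi)$ for all $\xi\in S^1$. It is non-trivial if it is not a single point. Slab: $S_M(\xi)$ is the closed set of points between the two parallel lines $H_M(\xi)$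 and $H_M(-\xi)$. When $-h_M(-\xi)\le h_M(\xi)$ this is $S_M(\xi)=\{x\in\mathbb{R}^2:-h_M(-\xi)\le\langle x,\xi\rangle\le h_M(\xi)\}$; for origin-symmetric $M$ it is $\{x\in\mathbb{R}^2:|\langle x,\xi\rangle|\le|h_M(\xi)|\}$. *)

theory Defs
  imports "HOL-Analysis.Analysis"
begin

definition convex_polygon :: "(real^2) set \<Rightarrow> bool" where
  "convex_polygon P \<longleftrightarrow> polytope P \<and> interior P \<noteq> {}"

definition origin_symmetric :: "(real^2) set \<Rightarrow> bool" where
  "origin_symmetric K \<longleftrightarrow> (\<forall>v\<in>K. - v \<in> K)"

definition circle_point :: "real \<Rightarrow> real^2" where
  "circle_point \<theta> = vector [cos \<theta>, sin \<theta>]"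

definition circle_normal :: "real \<Rightarrow> real^2" where
  "circle_normal \<theta> = vector [- sin \<theta>, cos \<theta>]"

definition real_analytic :: "(real \<Rightarrow> real) \<Rightarrow> bool" where
  "real_analytic f \<longleftrightarrow>
     (\<forall>x. \<exists>a. \<exists>r>0. \<forall>y. \<bar>y - x\<bar> < r \<longrightarrow> (\<lambda>n. a n * (y - x) ^ n) sums f y)"

text \<open>
  A hedgehog is given by its support function \<open>h\<close>, of which only the values on the unit circle
  \<open>sphere 0 1\<close> matter.  It is regarded as a function of the angle by composing
  with \<^const>\<open>circle_point\<close>, which makes it \<open>2\<pi>\<close>-periodic automatically.
\<close>

definition hedgehog :: "(real^2 \<Rightarrow> real) \<Rightarrow> (real^2) set" where
  "hedgehog h =
     (\<lambda>\<theta>. h (circle_point \<theta>) *\<^sub>R circle_point \<theta>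
          + deriv (\<lambda>t. h (circle_point t)) \<theta> *\<^sub>R circle_normal \<theta>) ` {0..2 * pi}"

definition analytic_hedgehog :: "(real^2 \<Rightarrow> real) \<Rightarrow> bool" where
  "analytic_hedgehog h \<longleftrightarrow> real_analytic (\<lambda>\<theta>. h (circle_point \<theta>))"

definition origin_symmetric_hedgehog :: "(real^2 \<Rightarrow> real) \<Rightarrow> bool" where
  "origin_symmetric_hedgehog h \<longleftrightarrow> (\<forall>\<xi>\<in>sphere 0 1. h (- \<xi>) = h \<xi>)"

definition nontrivial_hedgehog :: "(real^2 \<Rightarrow> real) \<Rightarrow> bool" where
  "nontrivial_hedgehog h \<longleftrightarrow> \<not> (\<exists>p. hedgehog h = {p})"

definition supporting_line :: "(real^2 \<Rightarrow> real) \<Rightarrow> real^2 \<Rightarrow> (real^2) set" where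
  "supporting_line h \<xi> = {x. x \<bullet> \<xi> = h \<xi>}"

text \<open>
  The line \<open>supporting_line h (- \<xi>)\<close> is \<open>{x. x \<bullet> \<xi> = - h (- \<xi>)}\<close>.  For a hedgehog that is not
  convex, either of \<open>h \<xi>\<close> and \<open>- h (- \<xi>)\<close> can be the larger one, hence the minimum and maximum.
\<close>

definition slab :: "(real^2 \<Rightarrow> real) \<Rightarrow> real^2 \<Rightarrow> (real^2) set" where
  "slab h \<xi> = {x. min (- h (- \<xi>)) (h \<xi>) \<le> x \<bullet> \<xi> \<and> x \<bullet> \<xi> \<le> max (- h (- \<xi>)) (h \<xi>)}"

lemma supporting_line_uminus: "supporting_line h (- \<xi>) = {x. x \<bullet> \<xi> = - h (- \<xi>)}"
  by (auto simp: supporting_line_def)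

lemma slab_eq:
  assumes "- h (- \<xi>) \<le> h \<xi>"
  shows "slab h \<xi> = {x. - h (- \<xi>) \<le> x \<bullet> \<xi> \<and> x \<bullet> \<xi> \<le> h \<xi>}"
  using assms by (simp add: slab_def)

lemma slab_origin_symmetric:
  assumes "origin_symmetric_hedgehog h" and "\<xi> \<in> sphere 0 1"
  shows "slab h \<xi> = {x. \<bar>x \<bullet> \<xi>\<bar> \<le> \<bar>h \<xi>\<bar>}"
proof -
  have "h (- \<xi>) = h \<xi>"
    using assms unfolding origin_symmetric_hedgehog_def by blast
  then show ?thesis
    unfolding slab_def by (auto simp: min_def max_def abs_if)
qed

lemma circle_point_sphere: "range circle_point = sphere 0 1"
proof
  show "range circle_point \<subseteq> sphere 0 1"
    by (auto simp: circle_point_def norm_vec_def L2_set_def sum_2)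
  show "sphere 0 1 \<subseteq> range circle_point"
  proof
    fix x :: "real^2" assume "x \<in> sphere 0 1"
    then have "(x $ 1)\<^sup>2 + (x $ 2)\<^sup>2 = 1"
      by (simp add: norm_vec_def L2_set_def sum_2)
    then obtain t where "x $ 1 = cos t" "x $ 2 = sin t"
      using sincos_total_2pi by blast
    then have "x = circle_point t"
      by (simp add: circle_point_def vec_eq_iff forall_2)
    then show "x \<in> range circle_point" by blast
  qed
qed

end

theory Submission
  imports Defs "HOL-Complex_Analysis.Conformal_Mappings"
begin

text \<open>
  Write \<open>\<xi>(t)\<close> for the unit vector of angle \<open>t\<close> and \<open>H t\<close> for the support function of the hedgehog
  at \<open>\<xi>(t)\<close>.  The tangent line of normal \<open>\<xi>(t)\<close> touches the hedgehog at a point \<open>m(t)\<close> in the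
  interior of both polygons, so it cuts each of them in a chord whose two ends lie on edges.

  Two nearby tangent lines cross near \<open>m(t)\<close>, and the parts of \<open>P\<close> on one side of them differ by two
  thin triangles with apex at the crossing.  Hence the right derivative of the area of \<open>P\<close> below the
  tangent line is half of \<open>r\<^sub>2\<^sup>2 - r\<^sub>1\<^sup>2\<close>, where \<open>r\<^sub>1\<close> and \<open>r\<^sub>2\<close> are the distances from \<open>m(t)\<close> to the
  forward and the backward end of the chord (\<open>chord_area_rate\<close>).  By symmetry the area below a line determines the area of the slab up to a
  constant and a sign (\<open>measure_slab\<close>), so the hypothesis makes \<open>r\<^sub>1\<^sup>2 - r\<^sub>2\<^sup>2\<close> equal for \<open>P\<close> and \<open>Q\<close>.

  The signed distance from \<open>m(t)\<close>, along the tangent, to the edge line of normal angle \<open>p\<close> and offset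
  \<open>c\<close> is \<open>(c - D\<^sub>p(t)) / sin (p - t)\<close> with \<open>D\<^sub>p(t) = H t * cos (p - t) + H' t * sin (p - t)\<close>.  While
  the four edges that carry the chord ends stay the same, the equality of the differences of squares is
  an identity between analytic functions.  Its cleared form therefore holds for all \<open>t\<close>, also at
  \<open>t + \<pi>\<close>, where \<open>D\<^sub>p\<close> and the sines change sign but \<open>c\<close> does not.  So the parts of odd and of even
  degree in \<open>c\<close> vanish separately.  The odd part is the derivative of \<open>H t\<close> times a signed sum of
  cosecants \<open>c / sin (p - t)\<close>.  That product is then constant, and, being antiperiodic, it is zero;
  hence so is the sum of cosecants (\<open>cosecant_balance\<close>).  Comparing poles, the edges of \<open>P\<close> are those of
  \<open>Q\<close>, either end by end or crosswise after reflection in the origin, and the even part rules out the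
  second possibility (\<open>edges_determined\<close>).  So the two polygons cut the same chord from the tangent
  lines in question.

  If \<open>P\<close> were not contained in \<open>Q\<close>, a tangent line would pass through a point of \<open>P\<close> outside \<open>Q\<close>,
  and all tangent lines nearby would have different chords in \<open>P\<close> and in \<open>Q\<close>, a contradiction
  (\<open>polygon_subset\<close>).
\<close>

section \<open>Real analytic functions as restrictions of holomorphic ones\<close>

text \<open>
  Locally extending to the complex plane makes closure under products and derivatives, and the
  identity theorem, consequences of complex analysis.
\<close>

definition extends_holomorphically :: "(real \<Rightarrow> real) \<Rightarrow> bool" where
  "extends_holomorphically f \<longleftrightarrow> (\<forall>x. \<exists>r>0. \<exists>g. g holomorphic_on ball (complex_of_real x) r \<and>
     (\<forall>y. \<bar>y - x\<bar> < r \<longrightarrow> g (of_real y) = of_real (f y)))"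

lemma extends_holomorphicallyE:
  assumes "extends_holomorphically f"
  obtains r g where "r > 0" "g holomorphic_on ball (complex_of_real x) r"
    "\<And>y. \<bar>y - x\<bar> < r \<Longrightarrow> g (of_real y) = of_real (f y)"
  using assms unfolding extends_holomorphically_def by metis

text \<open>The real power series converges on the whole complex disc of the same radius.\<close>

lemma real_analytic_imp_extends_holomorphically:
  assumes "real_analytic f"
  shows "extends_holomorphically f"
  unfolding extends_holomorphically_def
proof
  fix x
  obtain a r where r: "r > 0" and a: "\<And>y. \<bar>y - x\<bar> < r \<Longrightarrow> (\<lambda>n. a n * (y - x) ^ n) sums f y"
    using assms unfolding real_analytic_def by metis
  define g where "g z = (\<Sum>n. complex_of_real (a n) * (z - of_real x) ^ n)" for z
  have "(\<lambda>n. complex_of_real (a n) * (z - of_real x) ^ n) sums g z"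
    if "z \<in> ball (of_real x) r" for z
  proof -
    have "cmod (z - of_real x) < r"
      using that by (simp add: dist_norm norm_minus_commute)
    then obtain t where t: "cmod (z - of_real x) < t" "t < r"
      using dense by blast
    have "0 < t" using t(1) norm_ge_zero by (rule le_less_trans[rotated])
    then have "(\<lambda>n. a n * t ^ n) sums f (x + t)"
      using a[of "x + t"] t by simp
    then have "summable (\<lambda>n. complex_of_real (a n) * (of_real t) ^ n)"
      using summable_of_real[OF sums_summable, of "\<lambda>n. a n * t ^ n", where 'a=complex]
      by simp
    then have "summable (\<lambda>n. complex_of_real (a n) * (z - of_real x) ^ n)"
      by (rule powser_inside) (use t \<open>0 < t\<close> in simp)
    then show ?thesis unfolding g_def by (rule summable_sums)
  qed
  then have hol: "g holomorphic_on ball (of_real x) r"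
    by (rule power_series_holomorphic)
  have "g (of_real y) = of_real (f y)" if "\<bar>y - x\<bar> < r" for y
  proof -
    have "(\<lambda>n. complex_of_real (a n * (y - x) ^ n)) sums of_real (f y)"
      using a[OF that] by (rule sums_of_real)
    then show ?thesis
      unfolding g_def by (simp add: sums_iff)
  qed
  with hol r show "\<exists>r>0. \<exists>g. g holomorphic_on ball (complex_of_real x) r \<and>
     (\<forall>y. \<bar>y - x\<bar> < r \<longrightarrow> g (of_real y) = of_real (f y))" by blast
qed

lemma extends_holomorphically_entire:
  assumes "g holomorphic_on UNIV" and "\<And>y. g (of_real y) = of_real (f y)"
  shows "extends_holomorphically f"
  unfolding extends_holomorphically_def
  using assms holomorphic_on_subset[of g UNIV] by (intro allI exI[of _ 1]) auto

lemma extends_holomorphically_const: "extends_holomorphically (\<lambda>_. c)"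
  by (rule extends_holomorphically_entire[of "\<lambda>_. of_real c"]) auto

lemma extends_holomorphically_sin: "extends_holomorphically (\<lambda>t. sin (c - t))"
  by (rule extends_holomorphically_entire[of "\<lambda>z. sin (of_real c - z)"])
     (auto intro!: holomorphic_intros simp flip: of_real_diff sin_of_real)

lemma extends_holomorphically_cos: "extends_holomorphically (\<lambda>t. cos (c - t))"
  by (rule extends_holomorphically_entire[of "\<lambda>z. cos (of_real c - z)"])
     (auto intro!: holomorphic_intros simp flip: of_real_diff cos_of_real)

lemma extends_holomorphically_binop:
  fixes k :: "complex \<Rightarrow> complex \<Rightarrow> complex" and l :: "real \<Rightarrow> real \<Rightarrow> real"
  assumes "extends_holomorphically f" and "extends_holomorphically f'"
    and hol: "\<And>g g' S. g holomorphic_on S \<Longrightarrow> g' holomorphic_on S \<Longrightarrow> (\<lambda>z. k (g z) (g' z)) holomorphic_on S"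
    and real: "\<And>a b. k (of_real a) (of_real b) = of_real (l a b)"
  shows "extends_holomorphically (\<lambda>t. l (f t) (f' t))"
  unfolding extends_holomorphically_def
proof
  fix x
  obtain r g where 1: "r > 0" "g holomorphic_on ball (complex_of_real x) r"
    "\<And>y. \<bar>y - x\<bar> < r \<Longrightarrow> g (of_real y) = of_real (f y)" using extends_holomorphicallyE[OF assms(1)] by metis
  obtain r' g' where 2: "r' > 0" "g' holomorphic_on ball (complex_of_real x) r'"
    "\<And>y. \<bar>y - x\<bar> < r' \<Longrightarrow> g' (of_real y) = of_real (f' y)" using extends_holomorphicallyE[OF assms(2)] by metis
  have "(\<lambda>z. k (g z) (g' z)) holomorphic_on ball (complex_of_real x) (min r r')"
    by (intro hol holomorphic_on_subset[OF 1(2)] holomorphic_on_subset[OF 2(2)]) auto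
  then show "\<exists>r>0. \<exists>G. G holomorphic_on ball (complex_of_real x) r \<and>
     (\<forall>y. \<bar>y - x\<bar> < r \<longrightarrow> G (of_real y) = of_real (l (f y) (f' y)))"
    using 1 2 real by (intro exI[of _ "min r r'"]) auto
qed

lemma extends_holomorphically_add:
  "extends_holomorphically f \<Longrightarrow> extends_holomorphically g \<Longrightarrow> extends_holomorphically (\<lambda>t. f t + g t)"
  by (erule (1) extends_holomorphically_binop[of _ _ "(+)"]) (auto intro: holomorphic_intros)

lemma extends_holomorphically_diff:
  "extends_holomorphically f \<Longrightarrow> extends_holomorphically g \<Longrightarrow> extends_holomorphically (\<lambda>t. f t - g t)"
  by (erule (1) extends_holomorphically_binop[of _ _ "(-)"]) (auto intro: holomorphic_intros)

lemma extends_holomorphically_mult: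
  "extends_holomorphically f \<Longrightarrow> extends_holomorphically g \<Longrightarrow> extends_holomorphically (\<lambda>t. f t * g t)"
  by (erule (1) extends_holomorphically_binop[of _ _ "(*)"]) (auto intro: holomorphic_intros)

lemma extends_holomorphically_power: "extends_holomorphically f \<Longrightarrow> extends_holomorphically (\<lambda>t. f t ^ n)"
  by (induction n) (simp_all add: extends_holomorphically_const extends_holomorphically_mult)

lemmas extends_holomorphically_intros =
  extends_holomorphically_const extends_holomorphically_sin extends_holomorphically_cos
  extends_holomorphically_add extends_holomorphically_diff extends_holomorphically_mult
  extends_holomorphically_power

text \<open>
  The derivative of a local extension extends the real derivative: on the real axis the imaginary part
  of the extension vanishes, hence so does that of its derivative.
\<close>

lemma extends_holomorphically_deriv_local:
  assumes "r > 0" and hol: "g holomorphic_on ball (complex_of_real x) r"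
    and g: "\<And>y. \<bar>y - x\<bar> < r \<Longrightarrow> g (of_real y) = of_real (f y)"
    and y: "\<bar>y - x\<bar> < r"
  shows "(f has_real_derivative deriv f y) (at y)" "deriv g (of_real y) = of_real (deriv f y)"
proof -
  have gd: "(g has_field_derivative deriv g (of_real y)) (at (of_real y))"
    using hol y by (intro holomorphic_derivI[OF hol]) (simp_all add: dist_real_def abs_minus_commute)
  then have v: "((\<lambda>t. g (of_real t)) has_vector_derivative deriv g (of_real y)) (at y)"
    by (rule has_vector_derivative_real_field)
  have op: "open {x - r<..<x + r}" and yi: "y \<in> {x - r<..<x + r}" using y by (auto simp: abs_if split: if_splits)
  have Re: "(f has_real_derivative Re (deriv g (of_real y))) (at y)"
    by (rule DERIV_cong_ev[THEN iffD1, OF refl _ refl has_field_derivative_Re[OF v]])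
       (rule eventually_nhds[THEN iffD2], rule exI, rule conjI[OF op conjI[OF yi]], auto simp: g abs_if)
  have Im: "((\<lambda>_. 0) has_real_derivative Im (deriv g (of_real y))) (at y)"
    by (rule DERIV_cong_ev[THEN iffD1, OF refl _ refl has_field_derivative_Im[OF v]])
       (rule eventually_nhds[THEN iffD2], rule exI, rule conjI[OF op conjI[OF yi]], auto simp: g abs_if)
  have "Im (deriv g (of_real y)) = 0" using DERIV_unique[OF Im] by simp
  moreover have "deriv f y = Re (deriv g (of_real y))" using Re by (rule DERIV_imp_deriv)
  ultimately show "(f has_real_derivative deriv f y) (at y)" "deriv g (of_real y) = of_real (deriv f y)"
    using Re by (auto simp: complex_eq_iff)
qed

lemma extends_holomorphically_has_derivative:
  assumes "extends_holomorphically f"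
  shows "(f has_real_derivative deriv f x) (at x)"
proof -
  obtain r g where "r > 0" "g holomorphic_on ball (complex_of_real x) r"
    "\<And>y. \<bar>y - x\<bar> < r \<Longrightarrow> g (of_real y) = of_real (f y)"
    using extends_holomorphicallyE[OF assms] by metis
  then show ?thesis by (rule extends_holomorphically_deriv_local(1)) (use \<open>r > 0\<close> in auto)
qed

lemma extends_holomorphically_deriv:
  assumes "extends_holomorphically f"
  shows "extends_holomorphically (deriv f)"
  unfolding extends_holomorphically_def
proof
  fix x
  obtain r g where r: "r > 0" and g: "g holomorphic_on ball (complex_of_real x) r"
    "\<And>y. \<bar>y - x\<bar> < r \<Longrightarrow> g (of_real y) = of_real (f y)"
    using extends_holomorphicallyE[OF assms] by metis
  have "deriv g holomorphic_on ball (complex_of_real x) r"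
    using g(1) by (rule holomorphic_deriv) simp
  with r extends_holomorphically_deriv_local(2)[OF r g]
  show "\<exists>r>0. \<exists>g. g holomorphic_on ball (complex_of_real x) r \<and>
     (\<forall>y. \<bar>y - x\<bar> < r \<longrightarrow> g (of_real y) = of_real (deriv f y))"
    by blast
qed

lemma extends_holomorphically_continuous: "extends_holomorphically f \<Longrightarrow> continuous_on S f"
  by (intro continuous_at_imp_continuous_on ballI DERIV_isCont[OF extends_holomorphically_has_derivative])

text \<open>
  The set of points near which the function vanishes is open, and by analytic continuation inside a
  single disc its complement is open as well.
\<close>

lemma extends_holomorphically_identity:
  assumes "extends_holomorphically f" and ab: "a < b" and zero: "\<And>t. t \<in> {a<..<b} \<Longrightarrow> f t = 0"
  shows "f t = 0"
proof -
  define Z where "Z = {x. \<exists>e>0. \<forall>y. \<bar>y - x\<bar> < e \<longrightarrow> f y = 0}"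
  \<comment> \<open>inside one disc of extension, vanishing near a single point spreads to the whole disc\<close>
  have spread: "\<exists>r>0. \<forall>z\<in>Z. \<bar>z - x\<bar> < r \<longrightarrow> (\<forall>y. \<bar>y - x\<bar> < r \<longrightarrow> f y = 0)" for x
  proof -
    obtain r g where r: "r > 0" and g: "g holomorphic_on ball (complex_of_real x) r"
      "\<And>y. \<bar>y - x\<bar> < r \<Longrightarrow> g (of_real y) = of_real (f y)"
      using extends_holomorphicallyE[OF assms(1)] by metis
    have "f y = 0" if z: "z \<in> Z" "\<bar>z - x\<bar> < r" and y: "\<bar>y - x\<bar> < r" for z y
    proof -
      obtain e where e: "e > 0" "\<And>y. \<bar>y - z\<bar> < e \<Longrightarrow> f y = 0"
        using z(1) unfolding Z_def by blast
      define e' where "e' = min e (r - \<bar>z - x\<bar>)"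
      have e': "e' > 0" using e z by (simp add: e'_def)
      define U where "U = complex_of_real ` {t. \<bar>t - z\<bar> < e'}"
      have "U \<subseteq> ball (of_real x) r"
        unfolding U_def by (auto simp: dist_real_def abs_minus_commute e'_def)
      moreover have "complex_of_real z islimpt U"
        unfolding islimpt_approachable
      proof (intro allI impI)
        fix d :: real assume d: "d > 0"
        define s where "s = min (d/2) (e'/2)"
        have "0 < s" "s < d" "s < e'" using d e' by (auto simp: s_def)
        then have "complex_of_real (z + s) \<in> U" "complex_of_real (z + s) \<noteq> of_real z"
          "dist (complex_of_real (z + s)) (of_real z) < d"
          unfolding U_def by (auto intro!: imageI simp: dist_norm simp del: of_real_add simp flip: of_real_diff)
        then show "\<exists>x'\<in>U. x' \<noteq> complex_of_real z \<and> dist x' (complex_of_real z) < d" by blast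
      qed
      moreover have "g w = 0" if w: "w \<in> U" for w
      proof -
        obtain t where t: "w = of_real t" "\<bar>t - z\<bar> < e'" using w unfolding U_def by blast
        then have "\<bar>t - x\<bar> < r" "f t = 0" using e(2) by (auto simp: e'_def)
        then show ?thesis using g(2) t(1) by simp
      qed
      ultimately have "g (of_real y) = 0"
        using analytic_continuation[OF g(1), of U "of_real z" "of_real y"] z y
        by (simp add: dist_real_def abs_minus_commute)
      then show ?thesis using g(2)[OF y] by simp
    qed
    with r show ?thesis by blast
  qed
  have "open Z"
    unfolding open_dist
  proof (intro ballI)
    fix x assume x: "x \<in> Z"
    obtain r where r: "r > 0" "\<And>z y. z \<in> Z \<Longrightarrow> \<bar>z - x\<bar> < r \<Longrightarrow> \<bar>y - x\<bar> < r \<Longrightarrow> f y = 0"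
      using spread[of x] by blast
    have "y \<in> Z" if "dist y x < r" for y
    proof -
      have "\<forall>w. \<bar>w - y\<bar> < r - dist y x \<longrightarrow> f w = 0"
        using r(2)[OF x] r(1) by (auto simp: dist_real_def)
      then show ?thesis unfolding Z_def using that by (auto intro!: exI[of _ "r - dist y x"])
    qed
    then show "\<exists>e>0. \<forall>y. dist y x < e \<longrightarrow> y \<in> Z" using r by blast
  qed
  moreover have "open (- Z)"
    unfolding open_dist
  proof (intro ballI)
    fix x assume x: "x \<in> - Z"
    obtain r where r: "r > 0" "\<And>z y. z \<in> Z \<Longrightarrow> \<bar>z - x\<bar> < r \<Longrightarrow> \<bar>y - x\<bar> < r \<Longrightarrow> f y = 0"
      using spread[of x] by blast
    have "y \<in> - Z" if "dist y x < r" for y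
    proof
      assume "y \<in> Z"
      then have "\<forall>w. \<bar>w - x\<bar> < r \<longrightarrow> f w = 0" using r(2)[of y] that by (auto simp: dist_real_def)
      then have "x \<in> Z" unfolding Z_def using r(1) by blast
      with x show False by simp
    qed
    then show "\<exists>e>0. \<forall>y. dist y x < e \<longrightarrow> y \<in> - Z" using r by blast
  qed
  ultimately have "Z = {} \<or> Z = UNIV" using clopen[of Z] by (simp add: closed_def)
  moreover have "(a + b) / 2 \<in> Z"
    unfolding Z_def using ab
    by (auto intro!: exI[of _ "(b - a) / 2"] zero simp: abs_less_iff field_simps)
  ultimately have "t \<in> Z" by blast
  then obtain e where "e > 0" "\<And>y. \<bar>y - t\<bar> < e \<Longrightarrow> f y = 0" unfolding Z_def by blast
  then show ?thesis by simp
qed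

section \<open>The moving frame and the tangent lines of a hedgehog\<close>

lemma circle_inner:
  "circle_point s \<bullet> circle_point t = cos (s - t)"
  "circle_normal s \<bullet> circle_point t = sin (t - s)"
  "circle_normal s \<bullet> circle_normal t = cos (s - t)"
  by (simp_all add: circle_point_def circle_normal_def inner_vec_def sum_2 cos_diff sin_diff algebra_simps)

lemma circle_point_nz [simp]: "circle_point t \<noteq> 0"
  using circle_inner(1)[of t t] by auto

lemma frame_expansion:
  "x = (x \<bullet> circle_point t) *\<^sub>R circle_point t + (x \<bullet> circle_normal t) *\<^sub>R circle_normal t"
proof -
  have "(x1 * c + x2 * s) * c + (- x1 * s + x2 * c) * - s = x1"
    "(x1 * c + x2 * s) * s + (- x1 * s + x2 * c) * c = x2" if "s\<^sup>2 + c\<^sup>2 = 1" for x1 x2 c s :: real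
    using that by algebra+
  from this[OF sin_cos_squared_add[of t]] show ?thesis
    by (simp add: vec_eq_iff forall_2 circle_point_def circle_normal_def inner_vec_def sum_2)
qed

text \<open>Cramer's rule in the basis formed by the directions of two non-parallel lines.\<close>

lemma normal_expansion:
  assumes "sin (t - s) \<noteq> 0"
  shows "y = ((y \<bullet> circle_point t) / sin (t - s)) *\<^sub>R circle_normal s
           + (- (y \<bullet> circle_point s) / sin (t - s)) *\<^sub>R circle_normal t"
proof -
  have "sin (t - s) *\<^sub>R y = (y \<bullet> circle_point t) *\<^sub>R circle_normal s + (- (y \<bullet> circle_point s)) *\<^sub>R circle_normal t"
    by (simp add: vec_eq_iff forall_2 circle_point_def circle_normal_def inner_vec_def sum_2 sin_diff algebra_simps)
  then have "(1 / sin (t - s)) *\<^sub>R (sin (t - s) *\<^sub>R y) =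
    (1 / sin (t - s)) *\<^sub>R ((y \<bullet> circle_point t) *\<^sub>R circle_normal s + (- (y \<bullet> circle_point s)) *\<^sub>R circle_normal t)"
    by simp
  then show ?thesis using assms unfolding scaleR_add_right scaleR_scaleR by simp
qed

lemma circle_point_add_pi: "circle_point (t + pi) = - circle_point t"
  by (simp add: circle_point_def vec_eq_iff forall_2)

lemma circle_point_continuous [continuous_intros]: "continuous_on S circle_point"
  and circle_normal_continuous [continuous_intros]: "continuous_on S circle_normal"
proof -
  have cp: "circle_point = (\<lambda>t. cos t *\<^sub>R circle_point 0 + sin t *\<^sub>R circle_normal 0)"
    and cn: "circle_normal = (\<lambda>t. cos t *\<^sub>R circle_normal 0 - sin t *\<^sub>R circle_point 0)"
    by (simp_all add: fun_eq_iff vec_eq_iff forall_2 circle_point_def circle_normal_def)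
  show "continuous_on S circle_point" by (subst cp) (intro continuous_intros)
  show "continuous_on S circle_normal" by (subst cn) (intro continuous_intros)
qed

text \<open>The point at which the tangent line of normal angle \<open>t\<close> touches the hedgehog.\<close>

definition contact_point :: "(real \<Rightarrow> real) \<Rightarrow> real \<Rightarrow> real^2" where
  "contact_point H t = H t *\<^sub>R circle_point t + deriv H t *\<^sub>R circle_normal t"

lemma contact_point_inner: "contact_point H t \<bullet> circle_point p = H t * cos (p - t) + deriv H t * sin (p - t)"
  using cos_minus[of "t - p"] by (simp add: contact_point_def inner_add_left circle_inner)

lemma contact_point_continuous:
  assumes "extends_holomorphically H"
  shows "continuous_on S (contact_point H)"
  unfolding contact_point_def
  by (intro continuous_intros extends_holomorphically_continuous extends_holomorphically_deriv assms)

lemma interior_strict: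
  fixes P :: "'a::euclidean_space set"
  assumes "x \<in> interior P" "\<And>x. x \<in> P \<Longrightarrow> x \<bullet> u \<le> c" "u \<noteq> 0"
  shows "x \<bullet> u < c"
proof -
  have "P \<subseteq> {x. u \<bullet> x \<le> c}" using assms(2) by (auto simp: inner_commute)
  from interior_mono[OF this] assms(1) have "x \<in> interior {x. u \<bullet> x \<le> c}" by blast
  then have "u \<bullet> x < c" unfolding interior_halfspace_le[OF assms(3)] by simp
  then show ?thesis by (simp add: inner_commute)
qed

text \<open>
  The signed distance, along the tangent line at angle \<open>t\<close> in direction \<^term>\<open>circle_normal t\<close>, from
  the contact point to the line of normal angle \<open>p\<close> and offset \<open>c\<close>.
\<close>

definition edge_distance :: "(real \<Rightarrow> real) \<Rightarrow> real \<Rightarrow> real \<Rightarrow> real \<Rightarrow> real" where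
  "edge_distance H p c t = (c - contact_point H t \<bullet> circle_point p) / sin (p - t)"

abbreviation edge_point :: "(real \<Rightarrow> real) \<Rightarrow> real \<Rightarrow> real \<Rightarrow> real \<Rightarrow> real^2" where
  "edge_point H p c t \<equiv> contact_point H t + edge_distance H p c t *\<^sub>R circle_normal t"

lemma edge_point_on_edge:
  assumes "sin (p - t) \<noteq> 0"
  shows "edge_point H p c t \<bullet> circle_point p = c"
  using assms by (simp add: inner_add_left circle_inner edge_distance_def)

text \<open>
  The chord that the tangent line at angle \<open>t\<close> cuts from \<open>K\<close> runs from the supporting line with normal
  angle \<open>q\<close> and offset \<open>d\<close> to the one with normal angle \<open>p\<close> and offset \<open>c\<close>.  The signs of the sines
  say which end is the forward one.
\<close>

definition chord_edges :: "(real^2) set \<Rightarrow> (real \<Rightarrow> real) \<Rightarrow> real \<Rightarrow> real \<Rightarrow> real \<Rightarrow> real \<Rightarrow> real \<Rightarrow> bool" where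
  "chord_edges K H p c q d t \<longleftrightarrow>
    (\<forall>x\<in>K. x \<bullet> circle_point p \<le> c) \<and> (\<forall>x\<in>K. x \<bullet> circle_point q \<le> d) \<and>
    sin (p - t) > 0 \<and> sin (q - t) < 0 \<and> edge_point H p c t \<in> K \<and> edge_point H q d t \<in> K"

section \<open>Chord ends determine their edges\<close>

text \<open>
  Linear independence of cosecants: after clearing denominators, evaluate at the pole \<open>p\<close> of the first
  one, where the terms of the others vanish.
\<close>

lemma cosecant_independent:
  assumes ab: "a < b"
    and nz: "\<And>t. t \<in> {a<..<b} \<Longrightarrow> sin (p - t) \<noteq> 0 \<and> sin (q - t) \<noteq> 0 \<and> sin (r - t) \<noteq> 0 \<and> sin (s - t) \<noteq> 0"
    and zero: "\<And>t. t \<in> {a<..<b} \<Longrightarrow>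
      j / sin (p - t) + k / sin (q - t) + l / sin (r - t) + m / sin (s - t) = (0::real)"
    and "sin (p - q) \<noteq> 0" "sin (p - r) \<noteq> 0" "sin (p - s) \<noteq> 0"
  shows "j = 0"
proof -
  define N where "N t = j * sin (q - t) * sin (r - t) * sin (s - t) +
    k * sin (p - t) * sin (r - t) * sin (s - t) + l * sin (p - t) * sin (q - t) * sin (s - t) +
    m * sin (p - t) * sin (q - t) * sin (r - t)" for t
  have "extends_holomorphically N"
    unfolding N_def by (intro extends_holomorphically_intros)
  moreover have "N t = 0" if t: "t \<in> {a<..<b}" for t
  proof -
    have "N t = (j / sin (p - t) + k / sin (q - t) + l / sin (r - t) + m / sin (s - t)) *
      (sin (p - t) * sin (q - t) * sin (r - t) * sin (s - t))"
      using nz[OF t] unfolding N_def by (simp add: field_simps)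
    then show ?thesis using zero[OF t] by simp
  qed
  ultimately have "N p = 0" using extends_holomorphically_identity ab by blast
  moreover have "N p = - j * sin (p - q) * sin (p - r) * sin (p - s)"
    unfolding N_def by (simp add: sin_diff algebra_simps)
  ultimately show ?thesis using assms(4-6) by simp
qed

text \<open>
  Two normals whose angles differ by a multiple of \<open>\<pi>\<close> are equal or opposite; the half-circles in which
  they lie tell which.
\<close>

lemma parallel_same_side:
  assumes "sin (p - q) = 0" "sin (p - t) * sin (q - t) > 0"
  shows "cos (p - q) = (1::real)" "sin (q - u) = sin (p - u)" "cos (q - u) = cos (p - u)"
proof -
  have eq: "sin (p - u) = cos (p - q) * sin (q - u)" "cos (p - u) = cos (p - q) * cos (q - u)" for u
    using sin_add[of "p - q" "q - u"] cos_add[of "p - q" "q - u"] assms(1) by simp_all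
  have "(cos (p - q) - 1) * (cos (p - q) + 1) = 0"
    using sin_cos_squared_add[of "p - q"] assms(1) by (simp add: algebra_simps power2_eq_square)
  moreover have "cos (p - q) \<noteq> -1"
  proof
    assume "cos (p - q) = -1"
    then have "sin (p - t) * sin (q - t) = - (sin (q - t))\<^sup>2" using eq(1)[of t] by (simp add: power2_eq_square)
    then show False using assms(2) by simp
  qed
  ultimately show one: "cos (p - q) = 1" by simp
  show "sin (q - u) = sin (p - u)" "cos (q - u) = cos (p - u)"
    using eq(1)[of u] eq(2)[of u] unfolding one by simp_all
qed

lemma parallel_opposite_side:
  assumes "sin (p - q) = 0" "sin (p - t) * sin (q - t) < 0"
  shows "cos (p - q) = (-1::real)" "sin (q - u) = - sin (p - u)" "cos (q - u) = - cos (p - u)"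
proof -
  have eq: "sin (p - (q + pi)) = - sin (p - q)" "cos (p - (q + pi)) = - cos (p - q)"
    "sin (q + pi - v) = - sin (q - v)" "cos (q + pi - v) = - cos (q - v)" for v
    by (simp_all add: sin_diff cos_diff)
  \<comment> \<open>turning \<open>q\<close> by \<open>\<pi>\<close> reduces this to normals on the same side\<close>
  have "sin (p - (q + pi)) = 0" "sin (p - t) * sin (q + pi - t) > 0"
    using assms unfolding eq by simp_all
  note parallel_same_side[OF this, unfolded eq]
  from this(1) this(2,3)[of u]
  show "cos (p - q) = -1" "sin (q - u) = - sin (p - u)" "cos (q - u) = - cos (p - u)"
    by linarith+
qed

lemma extends_holomorphically_contact_point_inner:
  assumes "extends_holomorphically H"
  shows "extends_holomorphically (\<lambda>t. contact_point H t \<bullet> circle_point p)"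
  unfolding contact_point_inner
  by (intro extends_holomorphically_intros assms extends_holomorphically_deriv)

text \<open>
  The identity is quadratic in the offsets.  Replacing \<open>t\<close> by \<open>t + \<pi>\<close> separates its odd part from its
  even one; the even one is the second claim.  The odd part integrates to a multiple of \<open>1 / H\<close>, which
  vanishes because \<open>H\<close> has period \<open>\<pi>\<close> whereas the cosecants are antiperiodic.
\<close>

lemma cosecant_balance:
  fixes H :: "real \<Rightarrow> real"
  defines "D \<equiv> \<lambda>p t. contact_point H t \<bullet> circle_point p"
  assumes H: "extends_holomorphically H" and per: "\<And>t. H (t + pi) = H t"
    and ab: "a < b" and nz: "\<And>t. t \<in> {a<..<b} \<Longrightarrow> H t \<noteq> 0"
    and S0: "\<And>t. t \<in> {a<..<b} \<Longrightarrow> sin (p1 - t) \<noteq> 0 \<and> sin (p2 - t) \<noteq> 0 \<and> sin (p3 - t) \<noteq> 0 \<and> sin (p4 - t) \<noteq> 0"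
    and id: "\<And>t. t \<in> {a<..<b} \<Longrightarrow>
      (edge_distance H p1 c1 t)\<^sup>2 - (edge_distance H p2 c2 t)\<^sup>2 =
      (edge_distance H p3 c3 t)\<^sup>2 - (edge_distance H p4 c4 t)\<^sup>2"
    and t0: "t0 \<in> {a<..<b}"
  shows "c1 / sin (p1 - t0) - c2 / sin (p2 - t0) - c3 / sin (p3 - t0) + c4 / sin (p4 - t0) = 0"
    and "((D p1 t0)\<^sup>2 + c1\<^sup>2) / (sin (p1 - t0))\<^sup>2 - ((D p2 t0)\<^sup>2 + c2\<^sup>2) / (sin (p2 - t0))\<^sup>2
      - ((D p3 t0)\<^sup>2 + c3\<^sup>2) / (sin (p3 - t0))\<^sup>2 + ((D p4 t0)\<^sup>2 + c4\<^sup>2) / (sin (p4 - t0))\<^sup>2 = 0"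
proof -
  have id: "((c1 - D p1 t) / sin (p1 - t))\<^sup>2 - ((c2 - D p2 t) / sin (p2 - t))\<^sup>2 =
      ((c3 - D p3 t) / sin (p3 - t))\<^sup>2 - ((c4 - D p4 t) / sin (p4 - t))\<^sup>2"
    if "t \<in> {a<..<b}" for t
    using id[OF that] unfolding edge_distance_def D_def .
  note dH = extends_holomorphically_has_derivative[OF H]
  have per': "deriv H (t + pi) = deriv H t" for t
  proof -
    have "((\<lambda>t. H (t + pi)) has_real_derivative deriv H (t + pi)) (at t)"
      using dH[of "t + pi"] by (simp add: DERIV_shift)
    then show ?thesis using per dH[of t] by (simp add: DERIV_unique)
  qed
  have Sper: "sin (p - (t + pi)) = - sin (p - t)" and Cper: "cos (p - (t + pi)) = - cos (p - t)"
    for p t :: real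
    using sin_periodic_pi[of "p - (t + pi)"] cos_periodic_pi[of "p - (t + pi)"] by simp_all
  have Dper: "D p (t + pi) = - D p t" for p t
    unfolding D_def contact_point_inner per per' Sper Cper by simp
  have S0: "sin (p1 - t) \<noteq> 0" "sin (p2 - t) \<noteq> 0" "sin (p3 - t) \<noteq> 0" "sin (p4 - t) \<noteq> 0"
    if "t \<in> {a<..<b}" for t using S0[OF that] by auto
  have Dhol: "extends_holomorphically (D p)" for p
    unfolding D_def by (rule extends_holomorphically_contact_point_inner[OF H])
  \<comment> \<open>the given identity with its denominators cleared\<close>
  define F where "F t =
    (c1 - D p1 t)\<^sup>2 * (sin (p2 - t) * sin (p3 - t) * sin (p4 - t))\<^sup>2 -
    (c2 - D p2 t)\<^sup>2 * (sin (p1 - t) * sin (p3 - t) * sin (p4 - t))\<^sup>2 -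
    (c3 - D p3 t)\<^sup>2 * (sin (p1 - t) * sin (p2 - t) * sin (p4 - t))\<^sup>2 +
    (c4 - D p4 t)\<^sup>2 * (sin (p1 - t) * sin (p2 - t) * sin (p3 - t))\<^sup>2" for t
  have "extends_holomorphically F"
    unfolding F_def by (intro extends_holomorphically_intros Dhol)
  moreover have F: "F t = (((c1 - D p1 t) / sin (p1 - t))\<^sup>2 - ((c2 - D p2 t) / sin (p2 - t))\<^sup>2 -
      ((c3 - D p3 t) / sin (p3 - t))\<^sup>2 + ((c4 - D p4 t) / sin (p4 - t))\<^sup>2) *
      (sin (p1 - t) * sin (p2 - t) * sin (p3 - t) * sin (p4 - t))\<^sup>2" if "t \<in> {a<..<b}" for t
    using S0[OF that] unfolding F_def by (simp add: divide_simps) (simp add: algebra_simps)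
  moreover have "F t = 0" if "t \<in> {a<..<b}" for t
    unfolding F[OF that] using id[OF that] by simp
  ultimately have F0: "F t = 0" for t using extends_holomorphically_identity ab by blast
  \<comment> \<open>the identity at \<open>t + \<pi>\<close>, which is the given one with each \<open>D\<close> negated\<close>
  have id': "((c1 + D p1 t) / sin (p1 - t))\<^sup>2 - ((c2 + D p2 t) / sin (p2 - t))\<^sup>2 -
      ((c3 + D p3 t) / sin (p3 - t))\<^sup>2 + ((c4 + D p4 t) / sin (p4 - t))\<^sup>2 = 0"
    if "t \<in> {a<..<b}" for t
  proof -
    have "F (t + pi) = (((c1 + D p1 t) / sin (p1 - t))\<^sup>2 - ((c2 + D p2 t) / sin (p2 - t))\<^sup>2 -
      ((c3 + D p3 t) / sin (p3 - t))\<^sup>2 + ((c4 + D p4 t) / sin (p4 - t))\<^sup>2) *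
      (sin (p1 - t) * sin (p2 - t) * sin (p3 - t) * sin (p4 - t))\<^sup>2"
      unfolding F_def Dper Sper
      using S0[OF that] by (simp add: divide_simps) (simp add: algebra_simps)
    then show ?thesis using F0 S0[OF that] by simp
  qed
  have odd: "c1 * D p1 t / (sin (p1 - t))\<^sup>2 - c2 * D p2 t / (sin (p2 - t))\<^sup>2
      - c3 * D p3 t / (sin (p3 - t))\<^sup>2 + c4 * D p4 t / (sin (p4 - t))\<^sup>2 = 0" (is "?o = 0")
    and even: "((D p1 t)\<^sup>2 + c1\<^sup>2) / (sin (p1 - t))\<^sup>2 - ((D p2 t)\<^sup>2 + c2\<^sup>2) / (sin (p2 - t))\<^sup>2
      - ((D p3 t)\<^sup>2 + c3\<^sup>2) / (sin (p3 - t))\<^sup>2 + ((D p4 t)\<^sup>2 + c4\<^sup>2) / (sin (p4 - t))\<^sup>2 = 0" (is "?e = 0")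
    if "t \<in> {a<..<b}" for t
  proof -
    have sq: "((x + y) / z)\<^sup>2 = (y\<^sup>2 + x\<^sup>2) / z\<^sup>2 + 2 * (x * y / z\<^sup>2)"
      "((x - y) / z)\<^sup>2 = (y\<^sup>2 + x\<^sup>2) / z\<^sup>2 - 2 * (x * y / z\<^sup>2)" for x y z :: real
      by (simp_all add: power2_eq_square add_divide_distrib diff_divide_distrib algebra_simps)
    show "?o = 0" "?e = 0"
      using id[OF that] id'[OF that] unfolding sq by linarith+
  qed
  \<comment> \<open>the odd part is the derivative of \<open>H * G\<close>\<close>
  define G where "G t = c1 / sin (p1 - t) - c2 / sin (p2 - t) - c3 / sin (p3 - t) + c4 / sin (p4 - t)" for t
  have dHG: "((\<lambda>t. H t * G t) has_real_derivative 0) (at t)" if t: "t \<in> {a<..<b}" for t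
  proof -
    have "((\<lambda>t. H t * (c / sin (p - t))) has_real_derivative c * D p t / (sin (p - t))\<^sup>2) (at t)"
      if "sin (p - t) \<noteq> 0" for c p
      unfolding D_def contact_point_inner
      by (rule derivative_eq_intros dH refl that)+ (use that in \<open>simp add: field_simps power2_eq_square\<close>)
    note this[of p1 c1, OF S0(1)[OF t]] this[of p2 c2, OF S0(2)[OF t]]
      this[of p3 c3, OF S0(3)[OF t]] this[of p4 c4, OF S0(4)[OF t]]
    from DERIV_add[OF DERIV_diff[OF DERIV_diff[OF this(1,2)] this(3)] this(4)]
    show ?thesis unfolding G_def odd[OF t] by (simp add: algebra_simps)
  qed
  obtain K where K: "\<And>t. t \<in> {a<..<b} \<Longrightarrow> H t * G t = K"
    using has_field_derivative_zero_constant[of "{a<..<b}" "\<lambda>t. H t * G t"] dHG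
    by (meson convex_real_interval(8) has_field_derivative_at_within)
  \<comment> \<open>\<open>H * G = K\<close> with its denominators cleared, which makes sense across the poles\<close>
  define N where "N t = c1 * sin (p2 - t) * sin (p3 - t) * sin (p4 - t)
      - c2 * sin (p1 - t) * sin (p3 - t) * sin (p4 - t) - c3 * sin (p1 - t) * sin (p2 - t) * sin (p4 - t)
      + c4 * sin (p1 - t) * sin (p2 - t) * sin (p3 - t)" for t
  define R where "R t = sin (p1 - t) * sin (p2 - t) * sin (p3 - t) * sin (p4 - t)" for t
  have N: "N t = G t * R t" if "t \<in> {a<..<b}" for t
    using S0[OF that] unfolding N_def G_def R_def by (simp add: field_simps)
  have "extends_holomorphically (\<lambda>t. H t * N t - K * R t)"
    unfolding N_def R_def by (intro extends_holomorphically_intros H)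
  moreover have "H t * N t - K * R t = 0" if "t \<in> {a<..<b}" for t
    using K[OF that] N[OF that] by (simp add: algebra_simps)
  ultimately have HN: "H t * N t = K * R t" for t
    using extends_holomorphically_identity[of "\<lambda>t. H t * N t - K * R t" a b t] ab by simp
  have G0: "G t = 0" if t: "t \<in> {a<..<b}" for t
  proof -
    \<comment> \<open>there are three sine factors in \<open>N\<close> and four in \<open>R\<close>\<close>
    have "R (t + pi) = R t" "N (t + pi) = - N t" unfolding R_def N_def Sper by simp_all
    then have "K * R t = 0" using HN[of t] HN[of "t + pi"] per[of t] by simp
    then have "K = 0" using S0[OF t] by (simp add: R_def)
    then show ?thesis using K[OF t] nz[OF t] by simp
  qed
  from G0[OF t0] even[OF t0]
  show "c1 / sin (p1 - t0) - c2 / sin (p2 - t0) - c3 / sin (p3 - t0) + c4 / sin (p4 - t0) = 0"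
    and "((D p1 t0)\<^sup>2 + c1\<^sup>2) / (sin (p1 - t0))\<^sup>2 - ((D p2 t0)\<^sup>2 + c2\<^sup>2) / (sin (p2 - t0))\<^sup>2
      - ((D p3 t0)\<^sup>2 + c3\<^sup>2) / (sin (p3 - t0))\<^sup>2 + ((D p4 t0)\<^sup>2 + c4\<^sup>2) / (sin (p4 - t0))\<^sup>2 = 0"
    unfolding G_def by simp_all
qed

text \<open>
  Compare poles in the balance of cosecants, according to which normals are parallel.  Parallel edges
  at the two ends of a chord are opposite edges of one symmetric polygon, so they have equal offsets;
  this settles the case in which all four are parallel.
\<close>

lemma edges_determined:
  fixes H :: "real \<Rightarrow> real"
  assumes H: "extends_holomorphically H" and per: "\<And>t. H (t + pi) = H t"
    and ab: "a < b" and nz: "\<And>t. t \<in> {a<..<b} \<Longrightarrow> H t \<noteq> 0"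
    and S: "\<And>t. t \<in> {a<..<b} \<Longrightarrow> sin (p1 - t) > 0 \<and> sin (p2 - t) < 0 \<and> sin (p3 - t) > 0 \<and> sin (p4 - t) < 0"
    and c: "c1 > 0" "c2 > 0" "c3 > 0" "c4 > 0"
    and sym12: "cos (p1 - p2) = -1 \<Longrightarrow> c1 = c2" and sym34: "cos (p3 - p4) = -1 \<Longrightarrow> c3 = c4"
    and id: "\<And>t. t \<in> {a<..<b} \<Longrightarrow>
      (edge_distance H p1 c1 t)\<^sup>2 - (edge_distance H p2 c2 t)\<^sup>2 =
      (edge_distance H p3 c3 t)\<^sup>2 - (edge_distance H p4 c4 t)\<^sup>2"
  shows "sin (p1 - p3) = 0 \<and> c1 = c3 \<and> sin (p2 - p4) = 0 \<and> c2 = c4"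
proof -
  define D where "D p t = contact_point H t \<bullet> circle_point p" for p t
  have S0: "sin (p1 - t) \<noteq> 0" "sin (p2 - t) \<noteq> 0" "sin (p3 - t) \<noteq> 0" "sin (p4 - t) \<noteq> 0"
    if "t \<in> {a<..<b}" for t using S[OF that] by auto
  have S0': "sin (p1 - t) \<noteq> 0 \<and> sin (p2 - t) \<noteq> 0 \<and> sin (p3 - t) \<noteq> 0 \<and> sin (p4 - t) \<noteq> 0"
    if "t \<in> {a<..<b}" for t using S0[OF that] by simp
  have G0': "c1 / sin (p1 - t) - c2 / sin (p2 - t) - c3 / sin (p3 - t) + c4 / sin (p4 - t) = 0"
    if "t \<in> {a<..<b}" for t
    by (rule cosecant_balance(1)[OF H per ab nz S0' id that])
  have even: "((D p1 t)\<^sup>2 + c1\<^sup>2) / (sin (p1 - t))\<^sup>2 - ((D p2 t)\<^sup>2 + c2\<^sup>2) / (sin (p2 - t))\<^sup>2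
      - ((D p3 t)\<^sup>2 + c3\<^sup>2) / (sin (p3 - t))\<^sup>2 + ((D p4 t)\<^sup>2 + c4\<^sup>2) / (sin (p4 - t))\<^sup>2 = 0"
    if "t \<in> {a<..<b}" for t
    unfolding D_def by (rule cosecant_balance(2)[OF H per ab nz S0' id that])
  have Dhol: "extends_holomorphically (D p)" for p
    unfolding D_def[abs_def] by (rule extends_holomorphically_contact_point_inner[OF H])
  define tt where "tt = (a + b) / 2"
  have tt: "tt \<in> {a<..<b}" using ab by (simp add: tt_def)
  have sgn: "sin (p1 - tt) > 0" "sin (p2 - tt) < 0" "sin (p3 - tt) > 0" "sin (p4 - tt) < 0"
    using S[OF tt] by auto
  have sgn12: "sin (p1 - tt) * sin (p2 - tt) < 0" and sgn14: "sin (p1 - tt) * sin (p4 - tt) < 0"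
    and sgn34: "sin (p3 - tt) * sin (p4 - tt) < 0" and sgn32: "sin (p3 - tt) * sin (p2 - tt) < 0"
    and sgn13: "sin (p1 - tt) * sin (p3 - tt) > 0" and sgn24: "sin (p2 - tt) * sin (p4 - tt) > 0"
    using sgn by (simp_all add: mult_pos_neg mult_neg_neg)
  have flip: "sin (x - y) = 0 \<longleftrightarrow> sin (y - x) = 0" for x y :: real
    using sin_minus[of "x - y"] by simp
  note ci = cosecant_independent[OF ab]
  show ?thesis
  proof (cases "sin (p1 - p3) = 0")
    case p13: True
    note e3 = parallel_same_side(2)[OF p13 sgn13]
    show ?thesis
    proof (cases "sin (p2 - p4) = 0")
      case p24: True
      note e4 = parallel_same_side(2)[OF p24 sgn24]
      show ?thesis
      proof (cases "sin (p1 - p2) = 0")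
        case p12: True
        note e2 = parallel_opposite_side[OF p12 sgn12]
        have "sin (p3 - p4) = 0" using e3[of p4] e2(2)[of p4] p24 by linarith
        then have "c3 = c4" using parallel_opposite_side(1)[OF _ sgn34] sym34 by simp
        moreover have "c1 = c2" using e2(1) sym12 by simp
        moreover have "c1 = c3"
        proof -
          have "(c2 - c4) * (2 / sin (p1 - tt)) = 0"
            using G0'[OF tt] unfolding e3 e4 e2(2) \<open>c1 = c2\<close> \<open>c3 = c4\<close>
            by (auto simp: left_diff_distrib)
          then show ?thesis using sgn \<open>c1 = c2\<close> \<open>c3 = c4\<close> by auto
        qed
        ultimately show ?thesis using p13 p24 by simp
      next
        case np12: False
        \<comment> \<open>terms with coefficient zero fill up the four cosecants of \<open>cosecant_independent\<close>\<close>
        have z: "(c1 - c3) / sin (p1 - t) + (c4 - c2) / sin (p2 - t) + 0 / sin (p2 - t) + 0 / sin (p2 - t) = 0"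
          if "t \<in> {a<..<b}" for t
          using G0'[OF that] unfolding e3 e4 by (simp add: diff_divide_distrib)
        have "c1 - c3 = 0" by (rule ci[OF _ z]) (use S0 np12 in auto)
        then show ?thesis using z[OF tt] sgn p13 p24 by simp
      qed
    next
      \<comment> \<open>the poles at \<open>p2\<close> and \<open>p4\<close> could only cancel against \<open>p1\<close>, but then they would coincide\<close>
      case np24: False
      have z: "- c2 / sin (p2 - t) + (c1 - c3) / sin (p1 - t) + c4 / sin (p4 - t) + 0 / sin (p4 - t) = 0"
        if "t \<in> {a<..<b}" for t
        using G0'[OF that] unfolding e3 by (simp add: diff_divide_distrib)
      have z': "c4 / sin (p4 - t) + (c1 - c3) / sin (p1 - t) + - c2 / sin (p2 - t) + 0 / sin (p2 - t) = 0"
        if "t \<in> {a<..<b}" for t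
        using z[OF that] by simp
      have "sin (p2 - p1) = 0"
      proof (rule ccontr)
        assume n: "sin (p2 - p1) \<noteq> 0"
        have "- c2 = 0" by (rule ci[OF _ z]) (use S0 n np24 in auto)
        then show False using c by simp
      qed
      moreover have "sin (p4 - p1) = 0"
      proof (rule ccontr)
        assume n: "sin (p4 - p1) \<noteq> 0"
        have "c4 = 0" by (rule ci[OF _ z']) (use S0 n np24 flip[of p2 p4] in auto)
        then show False using c by simp
      qed
      ultimately have "sin (p1 - p2) = 0" "sin (p1 - p4) = 0" using flip by blast+
      then have "sin (p2 - p4) = 0"
        using parallel_opposite_side(2)[OF _ sgn12, of p4] by simp
      with np24 show ?thesis by simp
    qed
  next
    case np13: False
    show ?thesis
    proof (cases "sin (p1 - p2) = 0")
      case p12: True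
      note e2 = parallel_opposite_side(2)[OF p12 sgn12]
      have z: "(c1 + c2) / sin (p1 - t) + - c3 / sin (p3 - t) + c4 / sin (p4 - t) + 0 / sin (p4 - t) = 0"
        if "t \<in> {a<..<b}" for t
        using G0'[OF that] unfolding e2 by (simp add: add_divide_distrib)
      have p14: "sin (p1 - p4) = 0"
      proof (rule ccontr)
        assume n: "sin (p1 - p4) \<noteq> 0"
        have "c1 + c2 = 0" by (rule ci[OF _ z]) (use S0 n np13 in auto)
        then show False using c by simp
      qed
      note e4 = parallel_opposite_side(2)[OF p14 sgn14]
      have z': "- c3 / sin (p3 - t) + (c1 + c2 - c4) / sin (p1 - t) + 0 / sin (p1 - t) + 0 / sin (p1 - t) = 0"
        if "t \<in> {a<..<b}" for t
        using z[OF that] unfolding e4 by (simp add: add_divide_distrib diff_divide_distrib)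
      have "- c3 = 0" by (rule ci[OF _ z']) (use S0 np13 flip[of p1 p3] in auto)
      then show ?thesis using c by simp
    next
      \<comment> \<open>the poles can only cancel crosswise: then the edges of \<open>Q\<close> are those of \<open>P\<close>, reflected and with
        the ends exchanged\<close>
      case np12: False
      have z: "c1 / sin (p1 - t) + - c2 / sin (p2 - t) + - c3 / sin (p3 - t) + c4 / sin (p4 - t) = 0"
        if "t \<in> {a<..<b}" for t using G0'[OF that] by simp
      have p14: "sin (p1 - p4) = 0"
      proof (rule ccontr)
        assume n: "sin (p1 - p4) \<noteq> 0"
        have "c1 = 0" by (rule ci[OF _ z]) (use S0 n np13 np12 in auto)
        then show False using c by simp
      qed
      note e4 = parallel_opposite_side[OF p14 sgn14]
      have z': "- c2 / sin (p2 - t) + (c1 - c4) / sin (p1 - t) + - c3 / sin (p3 - t) + 0 / sin (p3 - t) = 0"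
        if "t \<in> {a<..<b}" for t
        using z[OF that] unfolding e4 by (simp add: diff_divide_distrib)
      have p32: "sin (p3 - p2) = 0"
      proof (rule ccontr)
        assume n: "sin (p3 - p2) \<noteq> 0"
        have "- c2 = 0" by (rule ci[OF _ z']) (use S0 n np12 flip[of p1 p2] flip[of p2 p3] in auto)
        then show False using c by simp
      qed
      note e3 = parallel_opposite_side[OF p32 sgn32]
      have e3': "sin (p3 - t) = - sin (p2 - t)" "cos (p3 - t) = - cos (p2 - t)" for t
        using e3(2,3)[of t] by simp_all
      have z'': "(c1 - c4) / sin (p1 - t) + (c3 - c2) / sin (p2 - t) + 0 / sin (p2 - t) + 0 / sin (p2 - t) = 0"
        if "t \<in> {a<..<b}" for t
        using z'[OF that] unfolding e3' by (simp add: diff_divide_distrib)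
      have c14: "c1 - c4 = 0" by (rule ci[OF _ z'']) (use S0 np12 in auto)
      then have c41: "c4 = c1" by simp
      have c23: "c3 = c2" using z''[OF tt] sgn c41 by simp
      have D4: "D p4 t = - D p1 t" and D3: "D p3 t = - D p2 t" for t
        unfolding D_def contact_point_inner e3' e4 by simp_all
      \<comment> \<open>the even part of the identity now compares double poles at two different places\<close>
      define E where "E t = ((D p1 t)\<^sup>2 + c1\<^sup>2) * (sin (p2 - t))\<^sup>2 - ((D p2 t)\<^sup>2 + c2\<^sup>2) * (sin (p1 - t))\<^sup>2" for t
      have "extends_holomorphically E"
        unfolding E_def by (intro extends_holomorphically_intros Dhol)
      moreover have "E t = 0" if "t \<in> {a<..<b}" for t
      proof -
        have "((D p1 t)\<^sup>2 + c1\<^sup>2) / (sin (p1 - t))\<^sup>2 = ((D p2 t)\<^sup>2 + c2\<^sup>2) / (sin (p2 - t))\<^sup>2"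
          using even[OF that] unfolding D3 D4 e4 e3' c23 c41 power2_minus by linarith
        then show ?thesis using S0[OF that] unfolding E_def by (simp add: field_simps)
      qed
      ultimately have "E p1 = 0" using extends_holomorphically_identity ab by blast
      moreover have "(D p1 p1)\<^sup>2 + c1\<^sup>2 > 0" using c by (simp add: add_nonneg_pos)
      ultimately show ?thesis using np12 flip[of p1 p2] unfolding E_def by simp
    qed
  qed
qed

section \<open>Areas cut off by lines\<close>

text \<open>
  A convex set that contains the apex and one point on each side of an angle, both on the same supporting
  line, meets the angle in exactly the triangle spanned by these points.
\<close>

lemma wedge_eq_triangle:
  fixes P :: "'a::real_inner set"
  assumes "convex P" and "p \<in> P" and v: "p + \<rho> *\<^sub>R v \<in> P" and w: "p + \<sigma> *\<^sub>R w \<in> P"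
    and "\<rho> > 0" "\<sigma> > 0"
    and P: "\<And>x. x \<in> P \<Longrightarrow> x \<bullet> u \<le> c"
    and edge: "(p + \<rho> *\<^sub>R v) \<bullet> u = c" "(p + \<sigma> *\<^sub>R w) \<bullet> u = c" and "p \<bullet> u < c"
  shows "P \<inter> {p + a *\<^sub>R v + b *\<^sub>R w | a b. 0 \<le> a \<and> 0 \<le> b} = convex hull {p, p + \<rho> *\<^sub>R v, p + \<sigma> *\<^sub>R w}"
    (is "P \<inter> ?W = convex hull ?T")
proof
  show "convex hull ?T \<subseteq> P \<inter> ?W"
  proof (rule Int_greatest)
    show "convex hull ?T \<subseteq> P" using assms by (intro hull_minimal) auto
    show "convex hull ?T \<subseteq> ?W"
    proof
      fix x assume "x \<in> convex hull ?T"
      then obtain i j k where ijk: "0 \<le> i" "0 \<le> j" "0 \<le> k" "i + j + k = 1"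
        "x = i *\<^sub>R p + j *\<^sub>R (p + \<rho> *\<^sub>R v) + k *\<^sub>R (p + \<sigma> *\<^sub>R w)"
        unfolding convex_hull_3 by blast
      have "x = (i + j + k) *\<^sub>R p + (j * \<rho>) *\<^sub>R v + (k * \<sigma>) *\<^sub>R w"
        unfolding ijk(5) by (simp add: algebra_simps)
      then have "x = p + (j * \<rho>) *\<^sub>R v + (k * \<sigma>) *\<^sub>R w" using ijk(4) by simp
      moreover have "0 \<le> j * \<rho>" "0 \<le> k * \<sigma>" using ijk assms by simp_all
      ultimately show "x \<in> ?W" by blast
    qed
  qed
  show "P \<inter> ?W \<subseteq> convex hull ?T"
  proof
    fix x assume "x \<in> P \<inter> ?W"
    then obtain a b where x: "x \<in> P" "x = p + a *\<^sub>R v + b *\<^sub>R w" "0 \<le> a" "0 \<le> b" by blast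
    define e where "e = c - p \<bullet> u"
    have "e > 0" using assms by (simp add: e_def)
    have e: "\<rho> * (v \<bullet> u) = e" "\<sigma> * (w \<bullet> u) = e" using edge by (simp_all add: e_def algebra_simps)
    have "a * (v \<bullet> u) + b * (w \<bullet> u) \<le> e"
      using P[OF x(1)] unfolding x(2) by (simp add: e_def algebra_simps)
    moreover have "v \<bullet> u = e / \<rho>" "w \<bullet> u = e / \<sigma>" using e assms by (simp_all add: field_simps)
    ultimately have "(a / \<rho> + b / \<sigma>) * e \<le> 1 * e" by (simp add: algebra_simps)
    then have le: "a / \<rho> + b / \<sigma> \<le> 1" using \<open>e > 0\<close> by (simp only: mult_le_cancel_right_pos)
    have "x = (1 - a / \<rho> - b / \<sigma>) *\<^sub>R p + (a / \<rho>) *\<^sub>R (p + \<rho> *\<^sub>R v) + (b / \<sigma>) *\<^sub>R (p + \<sigma> *\<^sub>R w)"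
      using assms unfolding x(2) by (simp add: algebra_simps)
    moreover have "0 \<le> 1 - a / \<rho> - b / \<sigma>" "0 \<le> a / \<rho>" "0 \<le> b / \<sigma>"
      "(1 - a / \<rho> - b / \<sigma>) + a / \<rho> + b / \<sigma> = 1"
      using le x assms by simp_all
    ultimately show "x \<in> convex hull ?T" unfolding convex_hull_3 by blast
  qed
qed

lemma measure_triangle:
  fixes p v w :: "real^2"
  shows "measure lebesgue (convex hull {p, p + v, p + w}) = \<bar>v $ 1 * w $ 2 - w $ 1 * v $ 2\<bar> / 2"
proof -
  have "convex hull {p, p + v, p + w} \<in> sets lborel"
    by (simp add: borel_compact compact_convex_hull finite_imp_compact)
  then show ?thesis by (simp add: content_triangle abs_minus_commute mult.commute)
qed

definition below :: "(real^2) set \<Rightarrow> real \<Rightarrow> real \<Rightarrow> (real^2) set" where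
  "below P t k = P \<inter> {x. x \<bullet> circle_point t \<le> k}"

lemma lmeasurable_halfplanes:
  assumes "compact (P :: (real^2) set)"
  shows "below P t k \<in> lmeasurable" "P \<inter> {x. x \<bullet> u < k} \<in> lmeasurable"
    "P \<inter> {x. x \<bullet> u > k} \<in> lmeasurable"
proof -
  have P: "P \<in> lmeasurable" using assms by (rule lmeasurable_compact)
  have "{x. x \<bullet> u \<le> k} \<in> sets lebesgue" "{x. x \<bullet> u < k} \<in> sets lebesgue"
    "{x. x \<bullet> u > k} \<in> sets lebesgue" for u :: "real^2"
    by (auto intro!: sets_completionI_sets borel_closed borel_open simp: inner_commute[of _ u]
          closed_halfspace_le open_halfspace_lt open_halfspace_gt)
  with P show "below P t k \<in> lmeasurable" "P \<inter> {x. x \<bullet> u < k} \<in> lmeasurable"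
    "P \<inter> {x. x \<bullet> u > k} \<in> lmeasurable"
    unfolding below_def by (auto intro!: fmeasurable_Int_fmeasurable)
qed

lemma negligible_line: "negligible {x. x \<bullet> circle_point t = k}"
  using negligible_hyperplane[of "circle_point t" k] by (simp add: inner_commute)

text \<open>
  For \<open>k > 0\<close> the complement of the slab consists of two caps, which reflection in the origin exchanges.
  For \<open>k < 0\<close> the part below the line is itself one of these caps.
\<close>

lemma measure_slab:
  assumes P: "compact P" and sym: "origin_symmetric P" and "k \<noteq> 0"
  shows "measure lebesgue (P \<inter> {x. \<bar>x \<bullet> circle_point t\<bar> \<le> \<bar>k\<bar>}) =
    sgn k * (2 * measure lebesgue (below P t k) - measure lebesgue P)"
proof -
  let ?u = "circle_point t" and ?m = "measure lebesgue"
  note lm = lmeasurable_halfplanes[OF P] lmeasurable_compact[OF P]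
  have refl: "?m (P \<inter> {x. x \<bullet> ?u < - k}) = ?m (P \<inter> {x. x \<bullet> ?u > k})" for k
  proof -
    have "P \<inter> {x. x \<bullet> ?u < - k} = (\<lambda>x. (-1) *\<^sub>R x + 0) ` (P \<inter> {x. x \<bullet> ?u > k})"
    proof (intro equalityI subsetI)
      fix x assume "x \<in> P \<inter> {x. x \<bullet> ?u < - k}"
      then have "- x \<in> P \<inter> {x. x \<bullet> ?u > k}" using sym by (auto simp: origin_symmetric_def)
      then show "x \<in> (\<lambda>x. (-1) *\<^sub>R x + 0) ` (P \<inter> {x. x \<bullet> ?u > k})" by force
    qed (use sym in \<open>auto simp: origin_symmetric_def\<close>)
    then show ?thesis using measure_lebesgue_affine[of "-1" 0 "P \<inter> {x. x \<bullet> ?u > k}"] by simp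
  qed
  have add: "?m C = ?m A + ?m B" if "A \<in> lmeasurable" "B \<in> lmeasurable" "A \<inter> B = {}" "A \<union> B = C"
    for A B C :: "(real^2) set"
    using measure_Un2[OF that(1,2)] that(3,4) by (simp add: Diff_triv Int_commute)
  have tot: "?m P = ?m (below P t k) + ?m (P \<inter> {x. x \<bullet> ?u > k})" for k
    by (rule add) (auto simp: lm, auto simp: below_def)
  have pos: "?m (P \<inter> {x. \<bar>x \<bullet> ?u\<bar> \<le> k}) = 2 * ?m (below P t k) - ?m P" if "k > 0" for k
  proof -
    have "?m (below P t k) = ?m (P \<inter> {x. \<bar>x \<bullet> ?u\<bar> \<le> k}) + ?m (P \<inter> {x. x \<bullet> ?u < - k})"
    proof (rule add)
      have "P \<inter> {x. \<bar>x \<bullet> ?u\<bar> \<le> k} = below P t k - (P \<inter> {x. x \<bullet> ?u < - k})"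
        using that by (auto simp: below_def)
      then show "P \<inter> {x. \<bar>x \<bullet> ?u\<bar> \<le> k} \<in> lmeasurable" using fmeasurable.Diff[OF lm(1,2)] by simp
    qed (use that in \<open>auto simp: lm below_def\<close>)
    then show ?thesis using tot[of k] refl[of k] by simp
  qed
  show ?thesis
  proof (cases "k > 0")
    case True
    then show ?thesis using pos by simp
  next
    case False
    then have k: "- k > 0" using assms by simp
    have "?m (below P t k) = ?m (P \<inter> {x. x \<bullet> ?u < k})"
      by (rule measure_negligible_symdiff)
         (auto simp: lm below_def intro!: negligible_subset[OF negligible_line[of t k]])
    then show ?thesis using pos[OF k] refl[of "- k"] tot[of "- k"] k by simp
  qed
qed

text \<open>
  The lines of normal angles \<open>s\<close> and \<open>t\<close> through \<open>p\<close> bound two opposite angles, and the parts of \<open>P\<close>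
  below the two lines differ by what \<open>P\<close> contains of these angles.  Each time that is a triangle.
\<close>

lemma below_difference:
  assumes P: "compact P" "convex P" and st: "0 < t - s" "t - s < pi" and p: "p \<in> P"
    and pos: "\<rho>1 > 0" "\<sigma>1 > 0" "\<rho>2 > 0" "\<sigma>2 > 0"
    and 1: "p + \<rho>1 *\<^sub>R circle_normal s \<in> P" "p + \<sigma>1 *\<^sub>R circle_normal t \<in> P"
      "\<And>x. x \<in> P \<Longrightarrow> x \<bullet> u1 \<le> c1" "p \<bullet> u1 < c1"
      "(p + \<rho>1 *\<^sub>R circle_normal s) \<bullet> u1 = c1" "(p + \<sigma>1 *\<^sub>R circle_normal t) \<bullet> u1 = c1"
    and 2: "p - \<rho>2 *\<^sub>R circle_normal s \<in> P" "p - \<sigma>2 *\<^sub>R circle_normal t \<in> P"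
      "\<And>x. x \<in> P \<Longrightarrow> x \<bullet> u2 \<le> c2" "p \<bullet> u2 < c2"
      "(p - \<rho>2 *\<^sub>R circle_normal s) \<bullet> u2 = c2" "(p - \<sigma>2 *\<^sub>R circle_normal t) \<bullet> u2 = c2"
  shows "measure lebesgue (below P s (p \<bullet> circle_point s)) - measure lebesgue (below P t (p \<bullet> circle_point t))
    = sin (t - s) / 2 * (\<rho>1 * \<sigma>1 - \<rho>2 * \<sigma>2)"
proof -
  let ?m = "measure lebesgue" and ?x = "circle_point s" and ?y = "circle_point t"
    and ?v = "circle_normal s" and ?w = "circle_normal t"
  define A B where "A = below P s (p \<bullet> ?x)" and "B = below P t (p \<bullet> ?y)"
  have lm: "A \<in> lmeasurable" "B \<in> lmeasurable" unfolding A_def B_def by (intro lmeasurable_halfplanes P)+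
  have sin: "sin (t - s) > 0" using st by (rule sin_gt_zero)
  have coeffs: "(p + a *\<^sub>R ?v + b *\<^sub>R ?w) \<bullet> ?x = p \<bullet> ?x - b * sin (t - s)"
    "(p + a *\<^sub>R ?v + b *\<^sub>R ?w) \<bullet> ?y = p \<bullet> ?y + a * sin (t - s)" for a b
    using sin_minus[of "t - s"] by (simp_all add: inner_add_left circle_inner)
  \<comment> \<open>in these coordinates at \<open>p\<close>, being below either line is a sign condition on one of them\<close>
  have cone: "\<exists>a b. x = p + a *\<^sub>R ?v + b *\<^sub>R ?w" for x
  proof -
    have "sin (t - s) \<noteq> 0" using sin by simp
    then obtain a b where "x - p = a *\<^sub>R ?v + b *\<^sub>R ?w" using normal_expansion by blast
    then have "x = p + a *\<^sub>R ?v + b *\<^sub>R ?w" by (simp add: diff_eq_eq add_ac)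
    then show ?thesis by blast
  qed
  have det: "\<bar>(\<rho> *\<^sub>R ?v) $ 1 * (\<sigma> *\<^sub>R ?w) $ 2 - (\<sigma> *\<^sub>R ?w) $ 1 * (\<rho> *\<^sub>R ?v) $ 2\<bar> / 2 = sin (t - s) / 2 * (\<rho> * \<sigma>)"
    if "\<rho> * \<sigma> > 0" for \<rho> \<sigma>
  proof -
    have "(\<rho> *\<^sub>R ?v) $ 1 * (\<sigma> *\<^sub>R ?w) $ 2 - (\<sigma> *\<^sub>R ?w) $ 1 * (\<rho> *\<^sub>R ?v) $ 2 = sin (t - s) * (\<rho> * \<sigma>)"
      by (simp add: circle_normal_def sin_diff algebra_simps)
    then show ?thesis using sin that by simp
  qed
  have AB: "?m (A - B) = sin (t - s) / 2 * (\<rho>1 * \<sigma>1)"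
  proof -
    have W: "P \<inter> {p + a *\<^sub>R ?v + b *\<^sub>R ?w | a b. 0 \<le> a \<and> 0 \<le> b} = convex hull {p, p + \<rho>1 *\<^sub>R ?v, p + \<sigma>1 *\<^sub>R ?w}"
      by (rule wedge_eq_triangle[OF P(2) p 1(1,2) pos(1,2) 1(3,5,6,4)])
    have sub: "A - B \<subseteq> P \<inter> {p + a *\<^sub>R ?v + b *\<^sub>R ?w | a b. 0 \<le> a \<and> 0 \<le> b}"
    proof
      fix x assume x: "x \<in> A - B"
      obtain a b where ab: "x = p + a *\<^sub>R ?v + b *\<^sub>R ?w" using cone by blast
      have "0 \<le> a" "0 \<le> b" "x \<in> P" using x sin unfolding A_def B_def below_def ab
        by (auto simp: coeffs zero_le_mult_iff mult_le_0_iff not_le)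
      then show "x \<in> P \<inter> {p + a *\<^sub>R ?v + b *\<^sub>R ?w | a b. 0 \<le> a \<and> 0 \<le> b}" using ab by blast
    qed
    have sup: "P \<inter> {p + a *\<^sub>R ?v + b *\<^sub>R ?w | a b. 0 \<le> a \<and> 0 \<le> b} - (A - B) \<subseteq> {x. x \<bullet> ?y = p \<bullet> ?y}"
      using sin by (auto simp: A_def B_def below_def coeffs mult_le_0_iff)
    have "?m (convex hull {p, p + \<rho>1 *\<^sub>R ?v, p + \<sigma>1 *\<^sub>R ?w}) = ?m (A - B)"
    proof (rule measure_negligible_symdiff)
      show "A - B \<in> lmeasurable" by (intro fmeasurable.Diff lm)
      show "negligible (A - B - convex hull {p, p + \<rho>1 *\<^sub>R ?v, p + \<sigma>1 *\<^sub>R ?w} \<union>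
          (convex hull {p, p + \<rho>1 *\<^sub>R ?v, p + \<sigma>1 *\<^sub>R ?w} - (A - B)))"
        by (rule negligible_subset[OF negligible_line]) (use sub[unfolded W] sup[unfolded W] in blast)
    qed
    then show ?thesis using det[of \<rho>1 \<sigma>1] pos by (simp add: measure_triangle)
  qed
  have BA: "?m (B - A) = sin (t - s) / 2 * (\<rho>2 * \<sigma>2)"
  proof -
    let ?W = "{p + a *\<^sub>R (- ?v) + b *\<^sub>R (- ?w) | a b. 0 \<le> a \<and> 0 \<le> b}" and ?T = "convex hull {p, p + \<rho>2 *\<^sub>R (- ?v), p + \<sigma>2 *\<^sub>R (- ?w)}"
    have W: "P \<inter> ?W = ?T"
      by (rule wedge_eq_triangle[OF P(2) p _ _ pos(3,4) 2(3) _ _ 2(4)]) (use 2 in simp_all)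
    have sub: "B - A \<subseteq> P \<inter> ?W"
    proof
      fix x assume x: "x \<in> B - A"
      obtain a b where ab: "x = p + a *\<^sub>R ?v + b *\<^sub>R ?w" using cone by blast
      have "a \<le> 0" "b \<le> 0" "x \<in> P" using x sin unfolding A_def B_def below_def ab
        by (auto simp: coeffs zero_le_mult_iff mult_le_0_iff mult_less_0_iff not_le)
      moreover have "x = p + (- a) *\<^sub>R (- ?v) + (- b) *\<^sub>R (- ?w)" using ab by simp
      ultimately show "x \<in> P \<inter> ?W" by (metis (mono_tags, lifting) IntI mem_Collect_eq neg_0_le_iff_le)
    qed
    have sup: "P \<inter> ?W - (B - A) \<subseteq> {x. x \<bullet> ?x = p \<bullet> ?x}"
    proof
      fix x assume x: "x \<in> P \<inter> ?W - (B - A)"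
      then obtain a b where ab: "x = p + (- a) *\<^sub>R ?v + (- b) *\<^sub>R ?w" "0 \<le> a" "0 \<le> b" by auto
      have "x \<bullet> ?y \<le> p \<bullet> ?y" "x \<bullet> ?x \<ge> p \<bullet> ?x" unfolding ab(1) coeffs using ab sin by simp_all
      with x show "x \<in> {x. x \<bullet> ?x = p \<bullet> ?x}" by (auto simp: A_def B_def below_def)
    qed
    have "?m ?T = ?m (B - A)"
    proof (rule measure_negligible_symdiff)
      show "B - A \<in> lmeasurable" by (intro fmeasurable.Diff lm)
      show "negligible (B - A - ?T \<union> (?T - (B - A)))"
        by (rule negligible_subset[OF negligible_line]) (use sub[unfolded W] sup[unfolded W] in blast)
    qed
    then show ?thesis using det[of "- \<rho>2" "- \<sigma>2"] pos
      using measure_triangle[of p "\<rho>2 *\<^sub>R (- ?v)" "\<sigma>2 *\<^sub>R (- ?w)"] by simp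
  qed
  have "?m A = ?m (A - B) + ?m (A \<inter> B)" "?m B = ?m (B - A) + ?m (A \<inter> B)"
    using measure_Un2[of "A \<inter> B" lebesgue A] measure_Un2[of "A \<inter> B" lebesgue B] lm
    by (simp_all add: fmeasurable.Int Un_absorb1 Diff_Int_distrib Diff_Int)
  then show ?thesis using AB BA unfolding A_def B_def by (simp add: algebra_simps)
qed

section \<open>The rate of change of the area below a tangent line\<close>

text \<open>
  As the second line tends to the first one, the triangles of \<open>below_difference\<close> have an area equivalent
  to half the square of the chord end's distance times the angle between the lines.
\<close>

lemma chord_area_rate:
  fixes H :: "real \<Rightarrow> real"
  assumes P: "compact P" "convex P" and H: "extends_holomorphically H" and s: "s \<in> {a<..<b}"
    and int: "\<And>t. t \<in> {a<..<b} \<Longrightarrow> contact_point H t \<in> interior P"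
    and edges: "\<And>t. t \<in> {a<..<b} \<Longrightarrow> chord_edges P H p1 c1 p2 c2 t"
  shows "((\<lambda>t. (measure lebesgue (below P s (H s)) - measure lebesgue (below P t (H t))) / (t - s))
    \<longlongrightarrow> ((edge_distance H p1 c1 s)\<^sup>2 - (edge_distance H p2 c2 s)\<^sup>2) / 2) (at_right s)"
proof -
  define R where "R = edge_distance H"
  have le1: "x \<bullet> circle_point p1 \<le> c1" and le2: "x \<bullet> circle_point p2 \<le> c2" if "x \<in> P" for x
    using edges[OF s] that unfolding chord_edges_def by blast+
  have E1: "sin (p1 - t) > 0 \<and> contact_point H t + R p1 c1 t *\<^sub>R circle_normal t \<in> P"
    and E2: "sin (p2 - t) < 0 \<and> contact_point H t + R p2 c2 t *\<^sub>R circle_normal t \<in> P"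
    if "t \<in> {a<..<b}" for t
    using edges[OF that] unfolding chord_edges_def R_def by blast+
  let ?F = "at_right s"
  \<comment> \<open>\<open>q t\<close> is the intersection of the tangent lines at \<open>s\<close> and \<open>t\<close>, and \<open>\<tau> t\<close>, \<open>\<tau>' t\<close> are its
    coordinates along them\<close>
  define K where "K t = H t - H s * cos (t - s)" for t
  define \<tau> where "\<tau> t = K t / sin (t - s)" for t
  define \<tau>' where "\<tau>' t = \<tau> t * cos (t - s) - H s * sin (t - s)" for t
  define q where "q t = H s *\<^sub>R circle_point s + \<tau> t *\<^sub>R circle_normal s" for t
  have "(K has_real_derivative deriv H s) (at s)"
    unfolding K_def by (rule derivative_eq_intros extends_holomorphically_has_derivative[OF H] refl)+ simp
  then have K: "((\<lambda>t. K t / (t - s)) \<longlongrightarrow> deriv H s) ?F"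
    using has_field_derivative_at_within[of K _ s "{s<..}"]
    by (simp add: has_field_derivative_iff K_def)
  have "((\<lambda>t. sin (t - s)) has_real_derivative 1) (at s)"
    by (rule derivative_eq_intros refl)+ simp
  then have sin: "((\<lambda>t. sin (t - s) / (t - s)) \<longlongrightarrow> 1) ?F"
    using has_field_derivative_at_within[of "\<lambda>t. sin (t - s)" _ s "{s<..}"]
    by (simp add: has_field_derivative_iff)
  have near: "eventually (\<lambda>t. s < t \<and> t < b \<and> t - s < pi) ?F"
    unfolding eventually_at_right_field using s pi_gt_zero
    by (intro exI[of _ "min b (s + pi)"]) auto
  have "((\<lambda>t. (K t / (t - s)) / (sin (t - s) / (t - s))) \<longlongrightarrow> deriv H s / 1) ?F"
    by (rule tendsto_divide[OF K sin]) simp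
  then have "(\<tau> \<longlongrightarrow> deriv H s / 1) ?F"
    by (rule Lim_transform_eventually) (use near in \<open>auto elim!: eventually_mono simp: \<tau>_def\<close>)
  then have \<tau>: "(\<tau> \<longlongrightarrow> deriv H s) ?F" by simp
  have id: "((\<lambda>t. t) \<longlongrightarrow> s) ?F" by (rule tendsto_ident_at)
  have "(\<tau>' \<longlongrightarrow> deriv H s * cos (s - s) - H s * sin (s - s)) ?F"
    unfolding \<tau>'_def by (intro tendsto_intros \<tau> id)
  then have \<tau>': "(\<tau>' \<longlongrightarrow> deriv H s) ?F" by simp
  have "(q \<longlongrightarrow> contact_point H s) ?F"
    unfolding q_def contact_point_def by (intro tendsto_intros \<tau>)
  then have qint: "eventually (\<lambda>t. q t \<in> interior P) ?F"
    using int[OF s] by (intro topological_tendstoD) auto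
  have cont: "(f \<longlongrightarrow> f s) ?F" if "continuous_on UNIV f" for f :: "real \<Rightarrow> 'b::topological_space"
    using that by (metis UNIV_I continuous_on_def tendsto_within_subset top_greatest)
  have dH: "(deriv H \<longlongrightarrow> deriv H s) ?F" by (intro cont extends_holomorphically_continuous extends_holomorphically_deriv H)
  have R: "(R p c \<longlongrightarrow> R p c s) ?F" if "sin (p - s) \<noteq> 0" for p c
    unfolding R_def edge_distance_def by (intro tendsto_intros id cont contact_point_continuous H that)
  have sin12: "sin (p1 - s) > 0" "sin (p2 - s) < 0" using E1[OF s] E2[OF s] by simp_all
  have R1pos: "R p1 c1 t > 0" and R2neg: "R p2 c2 t < 0" if "t \<in> {a<..<b}" for t
    using interior_strict[OF int[OF that] le1] interior_strict[OF int[OF that] le2] E1[OF that] E2[OF that]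
    by (simp_all add: R_def edge_distance_def divide_pos_neg)
  \<comment> \<open>the distances from \<open>q t\<close> to the ends of the chords at \<open>s\<close> and at \<open>t\<close>\<close>
  define \<rho>1 where "\<rho>1 t = deriv H s + R p1 c1 s - \<tau> t" for t
  define \<sigma>1 where "\<sigma>1 t = deriv H t + R p1 c1 t - \<tau>' t" for t
  define \<rho>2 where "\<rho>2 t = \<tau> t - deriv H s - R p2 c2 s" for t
  define \<sigma>2 where "\<sigma>2 t = \<tau>' t - deriv H t - R p2 c2 t" for t
  have "(\<rho>1 \<longlongrightarrow> deriv H s + R p1 c1 s - deriv H s) ?F" unfolding \<rho>1_def by (intro tendsto_intros \<tau>)
  then have \<rho>1: "(\<rho>1 \<longlongrightarrow> R p1 c1 s) ?F" by simp
  have "(\<sigma>1 \<longlongrightarrow> deriv H s + R p1 c1 s - deriv H s) ?F"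
    unfolding \<sigma>1_def using sin12 by (intro tendsto_intros \<tau>' dH R) simp
  then have \<sigma>1: "(\<sigma>1 \<longlongrightarrow> R p1 c1 s) ?F" by simp
  have "(\<rho>2 \<longlongrightarrow> deriv H s - deriv H s - R p2 c2 s) ?F" unfolding \<rho>2_def by (intro tendsto_intros \<tau>)
  then have \<rho>2: "(\<rho>2 \<longlongrightarrow> - R p2 c2 s) ?F" by simp
  have "(\<sigma>2 \<longlongrightarrow> deriv H s - deriv H s - R p2 c2 s) ?F"
    unfolding \<sigma>2_def using sin12 by (intro tendsto_intros \<tau>' dH R) simp
  then have \<sigma>2: "(\<sigma>2 \<longlongrightarrow> - R p2 c2 s) ?F" by simp
  have "eventually (\<lambda>t. \<rho>1 t > 0) ?F" "eventually (\<lambda>t. \<sigma>1 t > 0) ?F"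
    "eventually (\<lambda>t. \<rho>2 t > 0) ?F" "eventually (\<lambda>t. \<sigma>2 t > 0) ?F"
    using order_tendstoD(1)[OF \<rho>1 R1pos[OF s]] order_tendstoD(1)[OF \<sigma>1 R1pos[OF s]]
      order_tendstoD(1)[OF \<rho>2, of 0] order_tendstoD(1)[OF \<sigma>2, of 0] R2neg[OF s] by simp_all
  with near qint have "eventually (\<lambda>t. (measure lebesgue (below P s (H s)) - measure lebesgue (below P t (H t))) / (t - s)
      = sin (t - s) / (t - s) * ((\<rho>1 t * \<sigma>1 t - \<rho>2 t * \<sigma>2 t) / 2)) ?F"
  proof eventually_elim
    case (elim t)
    then have t: "t \<in> {a<..<b}" and ts: "0 < t - s" "t - s < pi" using s by auto
    have sint: "sin (t - s) > 0" using ts by (rule sin_gt_zero)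
    have qs: "q t \<bullet> circle_point s = H s"
      unfolding q_def by (simp add: inner_add_left circle_inner)
    have qt: "q t \<bullet> circle_point t = H t"
      unfolding q_def \<tau>_def K_def using sint cos_minus[of "s - t"]
      by (simp add: inner_add_left circle_inner)
    have "q t \<bullet> circle_normal t = \<tau>' t"
      unfolding q_def \<tau>'_def using sin_minus[of "t - s"] cos_minus[of "s - t"] circle_inner(2)[of t s]
      by (simp add: inner_add_left circle_inner inner_commute[of "circle_point s"])
    then have q: "q t = H t *\<^sub>R circle_point t + \<tau>' t *\<^sub>R circle_normal t"
      using frame_expansion[of "q t" t] qt by simp
    have ends: "q t + \<rho>1 t *\<^sub>R circle_normal s = contact_point H s + R p1 c1 s *\<^sub>R circle_normal s"
      "q t - \<rho>2 t *\<^sub>R circle_normal s = contact_point H s + R p2 c2 s *\<^sub>R circle_normal s"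
      unfolding \<rho>1_def \<rho>2_def contact_point_def q_def by (simp_all add: algebra_simps)
    have ends': "q t + \<sigma>1 t *\<^sub>R circle_normal t = contact_point H t + R p1 c1 t *\<^sub>R circle_normal t"
      "q t - \<sigma>2 t *\<^sub>R circle_normal t = contact_point H t + R p2 c2 t *\<^sub>R circle_normal t"
      unfolding \<sigma>1_def \<sigma>2_def contact_point_def q by (simp_all add: algebra_simps)
    note edge = edge_point_on_edge[of _ _ H, folded R_def]
    have qP: "q t \<in> P" using elim interior_subset by blast
    have "measure lebesgue (below P s (q t \<bullet> circle_point s)) - measure lebesgue (below P t (q t \<bullet> circle_point t))
      = sin (t - s) / 2 * (\<rho>1 t * \<sigma>1 t - \<rho>2 t * \<sigma>2 t)"
    proof (rule below_difference[OF P ts qP, of "\<rho>1 t" "\<sigma>1 t" "\<rho>2 t" "\<sigma>2 t" "circle_point p1" c1 "circle_point p2" c2])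
      show "q t \<bullet> circle_point p1 < c1" "q t \<bullet> circle_point p2 < c2"
        using interior_strict[OF _ le1, of "q t"] interior_strict[OF _ le2, of "q t"] elim by simp_all
    qed (use elim le1 le2 E1[OF s] E1[OF t] E2[OF s] E2[OF t] edge in \<open>simp_all only: ends ends' less_irrefl\<close>, auto)
    then have "measure lebesgue (below P s (H s)) - measure lebesgue (below P t (H t))
      = sin (t - s) * ((\<rho>1 t * \<sigma>1 t - \<rho>2 t * \<sigma>2 t) / 2)" unfolding qs qt by simp
    then show ?case by (simp only: times_divide_eq_left)
  qed
  moreover have "((\<lambda>t. sin (t - s) / (t - s) * ((\<rho>1 t * \<sigma>1 t - \<rho>2 t * \<sigma>2 t) / 2)) \<longlongrightarrow>
      1 * ((R p1 c1 s * R p1 c1 s - (- R p2 c2 s) * (- R p2 c2 s)) / 2)) ?F"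
    by (intro tendsto_intros sin \<rho>1 \<sigma>1 \<rho>2 \<sigma>2) simp
  ultimately show ?thesis
    unfolding R_def[symmetric] by (subst tendsto_cong) (simp_all add: power2_eq_square)
qed

section \<open>The edges that carry the ends of a chord\<close>

lemma polygon_edges:
  assumes "convex_polygon P"
  obtains E where "finite E" "P = {x. \<forall>(p, c) \<in> E. x \<bullet> circle_point p \<le> c}"
proof -
  obtain F where F: "finite F" "P = \<Inter> F" "\<And>h. h \<in> F \<Longrightarrow> \<exists>a b. a \<noteq> 0 \<and> h = {x. a \<bullet> x \<le> b}"
    using polytope_imp_polyhedron assms unfolding convex_polygon_def polyhedron_def by metis
  have "\<exists>e. h = {x. x \<bullet> circle_point (fst e) \<le> snd e}" if h: "h \<in> F" for h
  proof -
    obtain a b where ab: "a \<noteq> 0" "h = {x. a \<bullet> x \<le> b}" using F(3)[OF h] by blast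
    have "a /\<^sub>R norm a \<in> sphere 0 1" using ab by simp
    then obtain p where p: "a /\<^sub>R norm a = circle_point p" using circle_point_sphere by blast
    have "a \<bullet> x \<le> b \<longleftrightarrow> x \<bullet> circle_point p \<le> b / norm a" for x
      using ab(1) unfolding p[symmetric] by (simp add: field_simps inner_commute)
    then show ?thesis using ab(2) by (intro exI[of _ "(p, b / norm a)"]) simp
  qed
  then obtain f where f: "\<And>h. h \<in> F \<Longrightarrow> h = {x. x \<bullet> circle_point (fst (f h)) \<le> snd (f h)}" by metis
  have "x \<in> P \<longleftrightarrow> (\<forall>(p, c) \<in> f ` F. x \<bullet> circle_point p \<le> c)" for x
  proof -
    have "x \<in> P \<longleftrightarrow> (\<forall>h\<in>F. x \<in> h)" using F(2) by simp
    also have "\<dots> \<longleftrightarrow> (\<forall>h\<in>F. x \<bullet> circle_point (fst (f h)) \<le> snd (f h))" using f by blast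
    finally show ?thesis by (simp add: split_beta)
  qed
  then show ?thesis using that[of "f ` F"] F(1) by blast
qed

text \<open>
  The last point of the ray inside \<open>P\<close> satisfies one of the finitely many defining inequalities with
  equality, since otherwise the ray could be prolonged.
\<close>

lemma ray_leaves_through_edge:
  assumes P: "compact P" "P = {x. \<forall>(p, c) \<in> E. x \<bullet> circle_point p \<le> c}" and "finite E"
    and m: "m \<in> P" and d: "norm d = 1"
  obtains p c r where "(p, c) \<in> E" "r \<ge> 0" "m + r *\<^sub>R d \<in> P" "(m + r *\<^sub>R d) \<bullet> circle_point p = c"
proof -
  let ?f = "\<lambda>r. m + r *\<^sub>R d"
  obtain B where B: "\<And>x. x \<in> P \<Longrightarrow> norm x \<le> B"
    using compact_imp_bounded[OF P(1)] bounded_iff by blast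
  have bound: "r \<le> 2 * B" if "r \<ge> 0" "?f r \<in> P" for r
    using norm_triangle_ineq4[of "?f r" m] B[OF that(2)] B[OF m] d that(1) by simp
  define T where "T = {0..2 * B} \<inter> ?f -` P"
  have "compact T" unfolding T_def
    by (intro compact_Int_closed compact_Icc closed_vimage compact_imp_closed[OF P(1)] continuous_intros)
  moreover have "0 \<in> T" using m order_trans[OF norm_ge_zero B[OF m]] by (simp add: T_def)
  ultimately obtain r where r: "r \<in> T" "\<And>r'. r' \<in> T \<Longrightarrow> r' \<le> r" using compact_attains_sup[of T] by auto
  have "\<exists>(p, c) \<in> E. ?f r \<bullet> circle_point p = c"
  proof (rule ccontr)
    assume n: "\<not> (\<exists>(p, c) \<in> E. ?f r \<bullet> circle_point p = c)"
    define U where "U = (\<Inter>e\<in>E. {r. ?f r \<bullet> circle_point (fst e) < snd e})"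
    have mem: "x \<in> P \<longleftrightarrow> (\<forall>e\<in>E. x \<bullet> circle_point (fst e) \<le> snd e)" for x
      by (subst P(2)) (simp add: split_beta)
    have "open U" unfolding U_def using \<open>finite E\<close>
      by (intro open_INT ballI open_Collect_less continuous_intros)
    moreover have "r \<in> U" using r(1) n unfolding U_def T_def by (auto simp: less_le mem)
    ultimately obtain e where e: "e > 0" "\<And>r'. dist r' r < e \<Longrightarrow> r' \<in> U" unfolding open_dist by blast
    have "r + e / 2 \<in> U" using e by (simp add: dist_real_def)
    then have "?f (r + e / 2) \<in> P" unfolding U_def by (auto simp: mem intro: less_imp_le)
    then have "r + e / 2 \<in> T" using bound[of "r + e / 2"] r(1) e(1) by (simp add: T_def)
    then show False using r(2) e(1) by force
  qed
  then show ?thesis using that r(1) unfolding T_def by auto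
qed

lemma finite_closed_cover_interval:
  fixes T :: "'i \<Rightarrow> real set"
  assumes "finite I" "\<And>i. i \<in> I \<Longrightarrow> closed (T i)" "{a..b} \<subseteq> (\<Union>i\<in>I. T i)" "a < b"
  shows "\<exists>i\<in>I. \<exists>a' b'. a \<le> a' \<and> a' < b' \<and> b' \<le> b \<and> {a'..b'} \<subseteq> T i"
  using assms
proof (induction I arbitrary: a b rule: finite_induct)
  case empty
  then show ?case by simp
next
  case (insert i I)
  show ?case
  proof (cases "{a..b} \<subseteq> T i")
    case True
    then show ?thesis using insert.prems(3) by blast
  next
    case False
    then obtain x where x: "x \<in> {a..b}" "x \<in> - T i" by blast
    moreover have "open (- T i)" using insert.prems(1) by (simp add: open_Compl)
    ultimately obtain e where e: "e > 0" "\<And>y. dist y x < e \<Longrightarrow> y \<in> - T i" unfolding open_dist by blast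
    define a1 b1 where "a1 = max a (x - e / 2)" and "b1 = min b (x + e / 2)"
    have ab1: "a \<le> a1" "a1 < b1" "b1 \<le> b" using x(1) e(1) insert.prems(3) by (auto simp: a1_def b1_def)
    have "y \<in> - T i" if "y \<in> {a1..b1}" for y
      using that e by (intro e(2)) (auto simp: a1_def b1_def dist_real_def)
    moreover have "{a1..b1} \<subseteq> T i \<union> (\<Union>i\<in>I. T i)"
    proof -
      have "{a1..b1} \<subseteq> {a..b}" using ab1(1,3) by simp
      also have "\<dots> \<subseteq> T i \<union> (\<Union>i\<in>I. T i)" using insert.prems(2) by simp
      finally show ?thesis .
    qed
    ultimately have "{a1..b1} \<subseteq> (\<Union>i\<in>I. T i)" by blast
    then obtain j a' b' where "j \<in> I" "a1 \<le> a'" "a' < b'" "b' \<le> b1" "{a'..b'} \<subseteq> T j"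
      using insert.IH[of a1 b1] insert.prems(1) ab1 by blast
    then show ?thesis using ab1 by (intro bexI[of _ j] exI[of _ a'] exI[of _ b']) auto
  qed
qed

text \<open>
  The parameters for which a ray leaves through a given edge form a compact set, the projection of a
  compact set of pairs.  Finitely many of these sets cover the interval, so one of them contains a
  subinterval.
\<close>

lemma constant_exit_edge:
  assumes P: "compact P" "P = {x. \<forall>(p, c) \<in> E. x \<bullet> circle_point p \<le> c}" and "finite E"
    and m: "continuous_on UNIV m" "\<And>t. m t \<in> P"
    and d: "continuous_on UNIV d" "\<And>t::real. norm (d t) = 1" and "a < b"
  obtains p c a' b' where "(p, c) \<in> E" "a \<le> a'" "a' < b'" "b' \<le> b"
    "\<And>t. t \<in> {a'..b'} \<Longrightarrow> \<exists>r\<ge>0. m t + r *\<^sub>R d t \<in> P \<and> (m t + r *\<^sub>R d t) \<bullet> circle_point p = c"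
proof -
  obtain B where B: "\<And>x. x \<in> P \<Longrightarrow> norm x \<le> B"
    using compact_imp_bounded[OF P(1)] bounded_iff by blast
  have bound: "r \<le> 2 * B" if "r \<ge> 0" "m t + r *\<^sub>R d t \<in> P" for r t
    using norm_triangle_ineq4[of "m t + r *\<^sub>R d t" "m t"] B[OF that(2)] B[OF m(2)[of t]] d(2) that(1) by simp
  let ?f = "\<lambda>z. m (fst z) + snd z *\<^sub>R d (fst z)"
  define T where "T e = fst ` (({a..b} \<times> {0..2 * B}) \<inter> ?f -` (P \<inter> {x. x \<bullet> circle_point (fst e) = snd e}))" for e
  have f: "continuous_on UNIV ?f"
    by (intro continuous_intros continuous_on_compose2[OF m(1)] continuous_on_compose2[OF d(1)]) auto
  have "closed (T e)" for e
  proof -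
    have "compact (({a..b} \<times> {0..2 * B}) \<inter> ?f -` (P \<inter> {x. x \<bullet> circle_point (fst e) = snd e}))"
      by (intro compact_Int_closed compact_Times compact_Icc closed_vimage closed_Int
          compact_imp_closed[OF P(1)] f closed_Collect_eq continuous_intros)
    then show ?thesis unfolding T_def
      by (intro compact_imp_closed compact_continuous_image continuous_intros)
  qed
  moreover have "{a..b} \<subseteq> (\<Union>e\<in>E. T e)"
  proof
    fix t assume t: "t \<in> {a..b}"
    obtain p c r where pc: "(p, c) \<in> E" "r \<ge> 0" "m t + r *\<^sub>R d t \<in> P" "(m t + r *\<^sub>R d t) \<bullet> circle_point p = c"
      using ray_leaves_through_edge[OF P \<open>finite E\<close> m(2) d(2)] by blast
    then have "t \<in> T (p, c)" unfolding T_def using t bound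
      by (intro image_eqI[of _ _ "(t, r)"]) auto
    then show "t \<in> (\<Union>e\<in>E. T e)" using pc(1) by blast
  qed
  ultimately obtain e a' b' where e: "e \<in> E" "a \<le> a'" "a' < b'" "b' \<le> b" "{a'..b'} \<subseteq> T e"
    using finite_closed_cover_interval[of E T a b] \<open>finite E\<close> \<open>a < b\<close> by blast
  have "\<exists>r\<ge>0. m t + r *\<^sub>R d t \<in> P \<and> (m t + r *\<^sub>R d t) \<bullet> circle_point (fst e) = snd e"
    if "t \<in> {a'..b'}" for t
    using that e(5) unfolding T_def by force
  then show ?thesis using that[of "fst e" "snd e" a' b'] e by simp
qed

text \<open>Taking \<open>\<eta>\<close> to be \<open>1\<close> or \<open>-1\<close> treats the forward and the backward end of a chord alike.\<close>

lemma exit_is_edge_point: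
  assumes K: "\<And>x. x \<in> K \<Longrightarrow> x \<bullet> circle_point p \<le> c" "contact_point H t \<in> interior K"
    and "r \<ge> 0" "contact_point H t + r *\<^sub>R (\<eta> *\<^sub>R circle_normal t) \<in> K"
      "(contact_point H t + r *\<^sub>R (\<eta> *\<^sub>R circle_normal t)) \<bullet> circle_point p = c"
  shows "0 < \<eta> * sin (p - t) \<and> edge_point H p c t \<in> K"
proof -
  have "r * (\<eta> * sin (p - t)) = c - contact_point H t \<bullet> circle_point p"
    using assms(5) by (simp add: inner_add_left circle_inner)
  moreover have "contact_point H t \<bullet> circle_point p < c" by (rule interior_strict[OF K(2,1)]) simp_all
  ultimately have "r * (\<eta> * sin (p - t)) > 0" "edge_distance H p c t = r * \<eta>"
    unfolding edge_distance_def by (auto simp: field_simps)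
  with assms(3,4) show ?thesis by (auto simp: zero_less_mult_iff)
qed

lemma constant_chord_edges:
  assumes K: "convex_polygon K" and H: "extends_holomorphically H" and m: "\<And>t. contact_point H t \<in> interior K" and "a < b"
  obtains p c q d a' b' where "a \<le> a'" "a' < b'" "b' \<le> b"
    "\<And>t. t \<in> {a'..b'} \<Longrightarrow> chord_edges K H p c q d t"
proof -
  have cK: "compact K"
    using K unfolding convex_polygon_def by (auto intro: polytope_imp_compact)
  obtain E where E: "finite E" "K = {x. \<forall>(p, c) \<in> E. x \<bullet> circle_point p \<le> c}"
    using polygon_edges[OF K] by blast
  have le: "x \<bullet> circle_point p \<le> c" if "(p, c) \<in> E" "x \<in> K" for p c x using that E(2) by blast
  have m': "contact_point H t \<in> K" for t using m interior_subset by blast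
  have cn: "continuous_on UNIV (\<lambda>t. \<eta> *\<^sub>R circle_normal t)" "norm (\<eta> *\<^sub>R circle_normal t) = \<bar>\<eta>\<bar>" for \<eta> t
    using circle_inner(3) by (auto intro!: continuous_intros simp: norm_eq_sqrt_inner[of "circle_normal t"])
  note ce = constant_exit_edge[OF cK E(2,1) contact_point_continuous[OF H] m' cn(1)]
  obtain p c a1 b1 where 1: "(p, c) \<in> E" "a \<le> a1" "a1 < b1" "b1 \<le> b"
    "\<And>t. t \<in> {a1..b1} \<Longrightarrow> \<exists>r\<ge>0. contact_point H t + r *\<^sub>R (1 *\<^sub>R circle_normal t) \<in> K \<and>
      (contact_point H t + r *\<^sub>R (1 *\<^sub>R circle_normal t)) \<bullet> circle_point p = c"
    using ce[of 1 a b] cn(2)[of 1] \<open>a < b\<close> by (metis abs_one)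
  obtain q d a2 b2 where 2: "(q, d) \<in> E" "a1 \<le> a2" "a2 < b2" "b2 \<le> b1"
    "\<And>t. t \<in> {a2..b2} \<Longrightarrow> \<exists>r\<ge>0. contact_point H t + r *\<^sub>R ((-1) *\<^sub>R circle_normal t) \<in> K \<and>
      (contact_point H t + r *\<^sub>R ((-1) *\<^sub>R circle_normal t)) \<bullet> circle_point q = d"
    using ce[of "-1" a1 b1] cn(2)[of "-1"] 1(3) by (metis abs_one abs_minus_cancel)
  have "chord_edges K H p c q d t" if t: "t \<in> {a2..b2}" for t
  proof -
    have "t \<in> {a1..b1}" using t 2 by auto
    from 1(5)[OF this] 2(5)[OF t] show ?thesis
      using exit_is_edge_point[of K p c H t _ 1, OF le[OF 1(1)] m]
        exit_is_edge_point[of K q d H t _ "-1", OF le[OF 2(1)] m] le[OF 1(1)] le[OF 2(1)]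
      unfolding chord_edges_def by auto
  qed
  then show ?thesis using that[of a2 b2] 1 2 by (meson order_trans)
qed

lemma symmetric_offset_pos:
  assumes "origin_symmetric K" "\<And>x. x \<in> K \<Longrightarrow> x \<bullet> circle_point p \<le> c" "y \<in> interior K"
  shows "c > 0"
proof -
  have "- y \<in> K" using assms(1,3) interior_subset unfolding origin_symmetric_def by blast
  then have "- (y \<bullet> circle_point p) \<le> c" using assms(2)[of "- y"] by simp
  moreover have "y \<bullet> circle_point p < c" using interior_strict[OF assms(3,2)] by simp
  ultimately show ?thesis by linarith
qed

text \<open>Both offsets are values of the support function of \<open>K\<close>, at opposite directions.\<close>

lemma opposite_edges_same_offset:
  assumes "origin_symmetric K" and E: "chord_edges K H p c q d t" and cos: "cos (p - q) = -1"
  shows "c = d"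
proof -
  note E = E[unfolded chord_edges_def]
  have "(circle_point p + circle_point q) \<bullet> (circle_point p + circle_point q) = 0"
    using cos cos_minus[of "p - q"] by (simp add: inner_add_left inner_add_right circle_inner)
  then have q: "circle_point q = - circle_point p" by (simp add: add_eq_0_iff)
  have "- edge_point H p c t \<in> K" "- edge_point H q d t \<in> K"
    using E assms(1) unfolding origin_symmetric_def by blast+
  then have "- edge_point H p c t \<bullet> circle_point q \<le> d" "- edge_point H q d t \<bullet> circle_point p \<le> c"
    using E by blast+
  moreover have "edge_point H p c t \<bullet> circle_point p = c" "edge_point H q d t \<bullet> circle_point q = d"
    using E by (auto intro!: edge_point_on_edge)
  ultimately show ?thesis unfolding q inner_minus_left inner_minus_right by linarith
qed

section \<open>Equality of the polygons\<close>

text \<open>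
  Equal slab areas give equal rates of change, hence the balance that determines the edges.
\<close>

lemma chords_coincide:
  fixes P Q :: "(real^2) set" and H :: "real \<Rightarrow> real"
  assumes P: "convex_polygon P" "origin_symmetric P" and Q: "convex_polygon Q" "origin_symmetric Q"
    and H: "extends_holomorphically H" and per: "\<And>t. H (t + pi) = H t"
    and mP: "\<And>t. contact_point H t \<in> interior P" and mQ: "\<And>t. contact_point H t \<in> interior Q"
    and area: "\<And>t. measure lebesgue (P \<inter> {x. \<bar>x \<bullet> circle_point t\<bar> \<le> \<bar>H t\<bar>}) =
      measure lebesgue (Q \<inter> {x. \<bar>x \<bullet> circle_point t\<bar> \<le> \<bar>H t\<bar>})"
    and ab: "a < b" and sgn: "\<And>t. t \<in> {a<..<b} \<Longrightarrow> sgn (H t) = \<eta>" and "\<eta> \<noteq> 0"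
    and EP: "\<And>t. t \<in> {a<..<b} \<Longrightarrow> chord_edges P H p1 c1 p2 c2 t"
    and EQ: "\<And>t. t \<in> {a<..<b} \<Longrightarrow> chord_edges Q H p3 c3 p4 c4 t"
    and t: "t \<in> {a<..<b}"
  shows "edge_distance H p3 c3 t = edge_distance H p1 c1 t"
    and "edge_distance H p4 c4 t = edge_distance H p2 c2 t"
proof -
  have cP: "compact P" "convex P" and cQ: "compact Q" "convex Q"
    using P(1) Q(1) unfolding convex_polygon_def by (auto intro: polytope_imp_compact polytope_imp_convex)
  have nz: "H u \<noteq> 0" if "u \<in> {a<..<b}" for u using sgn[OF that] \<open>\<eta> \<noteq> 0\<close> by auto
  have V: "measure lebesgue (below P s (H s)) - measure lebesgue (below P t (H t)) =
      measure lebesgue (below Q s (H s)) - measure lebesgue (below Q t (H t))"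
    if "s \<in> {a<..<b}" "t \<in> {a<..<b}" for s t
  proof -
    have sg: "sgn (H u) = \<eta>" "H u \<noteq> 0" if "u \<in> {a<..<b}" for u
      using sgn nz that by blast+
    have "\<eta> * (2 * measure lebesgue (below P u (H u)) - measure lebesgue P) =
      \<eta> * (2 * measure lebesgue (below Q u (H u)) - measure lebesgue Q)"
      if "u \<in> {a<..<b}" for u
      using measure_slab[OF cP(1) P(2) sg(2)[OF that], of u] measure_slab[OF cQ(1) Q(2) sg(2)[OF that], of u]
        area[of u] sg(1)[OF that] by metis
    then have "2 * measure lebesgue (below P u (H u)) - measure lebesgue P =
      2 * measure lebesgue (below Q u (H u)) - measure lebesgue Q"
      if "u \<in> {a<..<b}" for u
      using that \<open>\<eta> \<noteq> 0\<close> by simp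
    from this[OF that(1)] this[OF that(2)] show ?thesis by linarith
  qed

  have id: "(edge_distance H p1 c1 t)\<^sup>2 - (edge_distance H p2 c2 t)\<^sup>2 =
      (edge_distance H p3 c3 t)\<^sup>2 - (edge_distance H p4 c4 t)\<^sup>2" if t: "t \<in> {a<..<b}" for t
  proof -
    have LP: "((\<lambda>u. (measure lebesgue (below P t (H t)) - measure lebesgue (below P u (H u))) / (u - t))
        \<longlongrightarrow> ((edge_distance H p1 c1 t)\<^sup>2 - (edge_distance H p2 c2 t)\<^sup>2) / 2) (at_right t)"
      by (rule chord_area_rate[OF cP H t mP EP])
    have LQ: "((\<lambda>u. (measure lebesgue (below Q t (H t)) - measure lebesgue (below Q u (H u))) / (u - t))
        \<longlongrightarrow> ((edge_distance H p3 c3 t)\<^sup>2 - (edge_distance H p4 c4 t)\<^sup>2) / 2) (at_right t)"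
      by (rule chord_area_rate[OF cQ H t mQ EQ])
    have "eventually (\<lambda>u. (measure lebesgue (below P t (H t)) - measure lebesgue (below P u (H u))) / (u - t) =
      (measure lebesgue (below Q t (H t)) - measure lebesgue (below Q u (H u))) / (u - t)) (at_right t)"
      unfolding eventually_at_right_field using t V[OF t] by (intro exI[of _ b]) auto
    from Lim_transform_eventually[OF LP this]
    have "((edge_distance H p1 c1 t)\<^sup>2 - (edge_distance H p2 c2 t)\<^sup>2) / 2 =
        ((edge_distance H p3 c3 t)\<^sup>2 - (edge_distance H p4 c4 t)\<^sup>2) / 2"
      by (rule tendsto_unique[OF trivial_limit_at_right_real _ LQ])
    then show ?thesis by simp
  qed
  have "sin (p1 - p3) = 0 \<and> c1 = c3 \<and> sin (p2 - p4) = 0 \<and> c2 = c4"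
  proof (rule edges_determined[OF H per ab nz _ _ _ _ _ _ _ id])
    show "sin (p1 - u) > 0 \<and> sin (p2 - u) < 0 \<and> sin (p3 - u) > 0 \<and> sin (p4 - u) < 0" if "u \<in> {a<..<b}" for u
      using EP[OF that] EQ[OF that] unfolding chord_edges_def by blast
    show "c1 > 0" "c2 > 0" "c3 > 0" "c4 > 0"
      using EP[OF t] EQ[OF t] symmetric_offset_pos[OF P(2) _ mP] symmetric_offset_pos[OF Q(2) _ mQ]
      unfolding chord_edges_def by blast+
    show "c1 = c2" if "cos (p1 - p2) = -1" by (rule opposite_edges_same_offset[OF P(2) EP[OF t] that])
    show "c3 = c4" if "cos (p3 - p4) = -1" by (rule opposite_edges_same_offset[OF Q(2) EQ[OF t] that])
  qed
  then have sin13: "sin (p1 - p3) = 0" and sin24: "sin (p2 - p4) = 0" and c: "c3 = c1" "c4 = c2" by simp_all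
  have pos: "sin (p1 - t) * sin (p3 - t) > 0" "sin (p2 - t) * sin (p4 - t) > 0"
    using EP[OF t] EQ[OF t] unfolding chord_edges_def by (simp_all add: mult_neg_neg)
  show "edge_distance H p3 c3 t = edge_distance H p1 c1 t" "edge_distance H p4 c4 t = edge_distance H p2 c2 t"
    unfolding edge_distance_def c contact_point_inner
    using parallel_same_side(2,3)[OF sin13 pos(1), of t] parallel_same_side(2,3)[OF sin24 pos(2), of t] by simp_all
qed

text \<open>
  At the normal angle of an edge of \<open>K\<close> that \<open>x\<close> violates, \<open>x\<close> lies above the tangent line, and at the
  opposite angle it lies below; a tangent line in between contains \<open>x\<close>.
\<close>

lemma tangent_line_through_outside_point:
  assumes K: "convex_polygon K" "x \<notin> K" and H: "extends_holomorphically H" and per: "\<And>t. H (t + pi) = H t"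
    and m: "\<And>t. contact_point H t \<in> interior K"
  obtains t where "x \<bullet> circle_point t = H t"
proof -
  obtain E where E: "K = {x. \<forall>(p, c) \<in> E. x \<bullet> circle_point p \<le> c}"
    using polygon_edges[OF K(1)] by blast
  obtain p c where pc: "(p, c) \<in> E" "x \<bullet> circle_point p > c" using K(2) E by force
  define g where "g t = x \<bullet> circle_point t - H t" for t
  have "contact_point H t \<bullet> circle_point p \<le> c" for t
    using m[of t] interior_subset[of K] pc(1) E by blast
  from this[of p] this[of "p + pi"] have "H p \<le> c" "- H p \<le> c"
    by (simp_all add: contact_point_inner per sin_minus[of pi, simplified])
  then have "g (p + pi) \<le> 0" "0 \<le> g p"
    using pc(2) unfolding g_def by (simp_all add: circle_point_add_pi per)
  moreover have "continuous_on {p..p + pi} g"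
    unfolding g_def by (intro continuous_intros extends_holomorphically_continuous H)
  ultimately obtain t where "g t = 0" using IVT2'[of g "p + pi" 0 p] pi_ge_zero by auto
  then show ?thesis using that unfolding g_def by simp
qed

text \<open>
  A point of \<open>P\<close> outside \<open>Q\<close> would give a whole range of tangent lines whose chords in \<open>P\<close> and \<open>Q\<close>
  differ.
\<close>

lemma polygon_subset:
  fixes P Q :: "(real^2) set" and H :: "real \<Rightarrow> real"
  assumes P: "convex_polygon P" "origin_symmetric P" and Q: "convex_polygon Q" "origin_symmetric Q"
    and H: "extends_holomorphically H" and per: "\<And>t. H (t + pi) = H t" and nz: "H t\<^sub>0 \<noteq> 0"
    and mP: "\<And>t. contact_point H t \<in> interior P" and mQ: "\<And>t. contact_point H t \<in> interior Q"
    and area: "\<And>t. measure lebesgue (P \<inter> {x. \<bar>x \<bullet> circle_point t\<bar> \<le> \<bar>H t\<bar>}) =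
      measure lebesgue (Q \<inter> {x. \<bar>x \<bullet> circle_point t\<bar> \<le> \<bar>H t\<bar>})"
  shows "P \<subseteq> Q"
proof
  fix x assume xP: "x \<in> P"
  show "x \<in> Q"
  proof (rule ccontr)
    assume xQ: "x \<notin> Q"
    have cP: "compact P" "convex P" and cQ: "compact Q" "convex Q"
      using P(1) Q(1) unfolding convex_polygon_def by (auto intro: polytope_imp_compact polytope_imp_convex)
    have mQ': "contact_point H t \<in> Q" for t
      using mQ interior_subset by blast
    obtain s where s: "x \<bullet> circle_point s = H s"
      using tangent_line_through_outside_point[OF Q(1) xQ H per mQ] by blast
    define r0 where "r0 = x \<bullet> circle_normal s - deriv H s"
    have x: "x = contact_point H s + r0 *\<^sub>R circle_normal s"
      using frame_expansion[of x s] s unfolding contact_point_def r0_def by (simp add: algebra_simps)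

    \<comment> \<open>move \<open>x\<close> along that line towards the contact point, into the interior of \<open>P\<close> but still outside \<open>Q\<close>\<close>
    have "open (- Q)" using cQ(1) by (simp add: compact_imp_closed open_Compl)
    with xQ obtain \<epsilon> where \<epsilon>: "\<epsilon> > 0" "\<And>y. dist y x < \<epsilon> \<Longrightarrow> y \<notin> Q" unfolding open_dist by auto
    define e where "e = min 1 (\<epsilon> / (2 * (norm (x - contact_point H s) + 1)))"
    have e: "0 < e" "e \<le> 1" using \<epsilon> by (auto simp: e_def add_nonneg_pos)
    define r where "r = (1 - e) * r0"
    define f where "f t = contact_point H t + r *\<^sub>R circle_normal t" for t
    have fs: "f s = x - e *\<^sub>R (x - contact_point H s)"
      unfolding f_def r_def by (subst (1 2) x) (simp add: algebra_simps)
    have "f s \<in> interior P"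
      unfolding fs using mem_interior_convex_shrink[OF cP(2) mP xP e] .
    moreover have "f s \<notin> Q"
    proof (rule \<epsilon>(2))
      have "e * norm (x - contact_point H s) \<le> \<epsilon> / (2 * (norm (x - contact_point H s) + 1)) * norm (x - contact_point H s)"
        by (intro mult_right_mono) (auto simp: e_def)
      also have "\<dots> < \<epsilon>"
      proof -
        have "N / (2 * (N + 1)) < 1" if "N \<ge> 0" for N :: real
          using that by (simp add: divide_less_eq)
        from mult_strict_left_mono[OF this[OF norm_ge_zero] \<epsilon>(1)] show ?thesis by simp
      qed
      finally show "dist (f s) x < \<epsilon>" unfolding fs using e by (simp add: dist_norm)
    qed
    ultimately have "f s \<in> interior P \<inter> - Q" by simp
    moreover have "continuous_on UNIV f"
      unfolding f_def by (intro continuous_intros contact_point_continuous H)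
    ultimately have "open (f -` (interior P \<inter> - Q))" "s \<in> f -` (interior P \<inter> - Q)"
      using \<open>open (- Q)\<close> by (auto intro!: open_vimage)
    then obtain d where d: "d > 0" "\<And>t. dist t s < d \<Longrightarrow> t \<in> f -` (interior P \<inter> - Q)"
      unfolding open_dist by blast

    \<comment> \<open>narrow the range of angles until \<open>H\<close> has a constant sign and the chord ends stay on fixed edges\<close>
    obtain t1 where t1: "t1 \<in> {s<..<s + d}" "H t1 \<noteq> 0"
      using extends_holomorphically_identity[OF H, of s "s + d" t\<^sub>0] d(1) nz by auto
    have "open {t. H t * H t1 > 0}"
      by (intro open_Collect_less continuous_intros extends_holomorphically_continuous H)
    then have "open ({t. H t * H t1 > 0} \<inter> {s<..<s + d})" by (intro open_Int) auto
    moreover have "t1 \<in> {t. H t * H t1 > 0} \<inter> {s<..<s + d}"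
      using t1 by (auto simp: zero_less_mult_iff)
    ultimately obtain \<delta> where \<delta>: "\<delta> > 0" "\<And>t. dist t t1 < \<delta> \<Longrightarrow> t \<in> {t. H t * H t1 > 0} \<inter> {s<..<s + d}"
      unfolding open_dist by blast
    have ab0: "t1 < t1 + \<delta> / 2" using \<delta> by simp
    have J0: "H t * H t1 > 0 \<and> f t \<in> P \<and> f t \<notin> Q" if "t \<in> {t1..t1 + \<delta> / 2}" for t
    proof -
      have "dist t t1 < \<delta>" using that \<delta>(1) by (auto simp: dist_real_def)
      then have t: "H t * H t1 > 0" "s < t" "t < s + d" using \<delta>(2) by auto
      then have "t \<in> f -` (interior P \<inter> - Q)" by (intro d(2)) (simp add: dist_real_def)
      then show ?thesis using t interior_subset by auto
    qed

    obtain p1 c1 p2 c2 a1 b1 where 1: "t1 \<le> a1" "a1 < b1" "b1 \<le> t1 + \<delta> / 2"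
      "\<And>t. t \<in> {a1..b1} \<Longrightarrow> chord_edges P H p1 c1 p2 c2 t"
      using constant_chord_edges[OF P(1) H mP ab0] by metis
    obtain p3 c3 p4 c4 a b where 2: "a1 \<le> a" "a < b" "b \<le> b1"
      "\<And>t. t \<in> {a..b} \<Longrightarrow> chord_edges Q H p3 c3 p4 c4 t"
      using constant_chord_edges[OF Q(1) H mQ 1(2)] by metis
    have J: "t \<in> {t1..t1 + \<delta> / 2}" "t \<in> {a1..b1}" "t \<in> {a..b}" if "t \<in> {a<..<b}" for t
      using that 1 2 by auto
    define t where "t = (a + b) / 2"
    have t: "t \<in> {a<..<b}" using 2(2) by (simp add: t_def)
    have sgn: "sgn (H u) = sgn (H t1)" if "u \<in> {a<..<b}" for u
      using J0[OF J(1)[OF that]] by (auto simp: sgn_if zero_less_mult_iff)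
    have sgn0: "sgn (H t1) \<noteq> 0" using t1(2) by (simp add: sgn_zero_iff)
    have R: "edge_distance H p3 c3 t = edge_distance H p1 c1 t"
      by (rule chords_coincide(1)[OF P Q H per mP mQ area 2(2) sgn sgn0 1(4)[OF J(2)] 2(4)[OF J(3)] t])
    have R': "edge_distance H p4 c4 t = edge_distance H p2 c2 t"
      by (rule chords_coincide(2)[OF P Q H per mP mQ area 2(2) sgn sgn0 1(4)[OF J(2)] 2(4)[OF J(3)] t])
    note EP = 1(4)[OF J(2)[OF t], unfolded chord_edges_def]
      and EQ = 2(4)[OF J(3)[OF t], unfolded chord_edges_def]

    \<comment> \<open>the point \<open>f t\<close> of the chord in \<open>P\<close> now lies on the chord in \<open>Q\<close>\<close>
    have ft: "f t \<in> P" "f t \<notin> Q" using J0[OF J(1)[OF t]] by auto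
    have lef: "f t \<bullet> circle_point p1 \<le> c1" "f t \<bullet> circle_point p2 \<le> c2"
      using EP ft(1) by blast+
    have "r \<noteq> 0" using ft(2) mQ' unfolding f_def by auto
    have seg: "f t \<in> Q" if "contact_point H t + R' *\<^sub>R circle_normal t \<in> Q" "0 \<le> r / R'" "r / R' \<le> 1" "R' \<noteq> 0" for R'
    proof -
      have "f t = (1 - r / R') *\<^sub>R contact_point H t + (r / R') *\<^sub>R (contact_point H t + R' *\<^sub>R circle_normal t)"
        using that(4) unfolding f_def by (simp add: algebra_simps)
      then show ?thesis using convexD_alt[OF cQ(2) mQ' that(1,2,3)] by simp
    qed
    show False
    proof (cases "r > 0")
      case True
      have "r * sin (p1 - t) \<le> c1 - contact_point H t \<bullet> circle_point p1"
        using lef(1) unfolding f_def by (simp add: inner_add_left circle_inner)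
      then have "r \<le> edge_distance H p1 c1 t" using EP unfolding edge_distance_def by (simp add: field_simps)
      then have "f t \<in> Q" using True EQ R by (intro seg[of "edge_distance H p1 c1 t"]) auto
      with ft show False by blast
    next
      case False
      with \<open>r \<noteq> 0\<close> have "r < 0" by simp
      have "r * sin (p2 - t) \<le> c2 - contact_point H t \<bullet> circle_point p2"
        using lef(2) unfolding f_def by (simp add: inner_add_left circle_inner)
      then have "edge_distance H p2 c2 t \<le> r" using EP unfolding edge_distance_def by (simp add: field_simps)
      then have "f t \<in> Q" using \<open>r < 0\<close> EQ R'
        by (intro seg[of "edge_distance H p2 c2 t"]) (auto simp: divide_le_eq zero_le_divide_iff)
      with ft show False by blast
    qed
  qed
qed

theorem theorem1p2:
  fixes P Q :: "(real^2) set" and h :: "real^2 \<Rightarrow> real"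
  assumes "convex_polygon P" and "origin_symmetric P"
    and "convex_polygon Q" and "origin_symmetric Q"
    and "analytic_hedgehog h" and "origin_symmetric_hedgehog h" and "nontrivial_hedgehog h"
    and "hedgehog h \<subseteq> interior P" and "hedgehog h \<subseteq> interior Q"
    and "\<And>\<xi>. \<xi> \<in> sphere 0 1 \<Longrightarrow>
           measure lebesgue (P \<inter> slab h \<xi>) = measure lebesgue (Q \<inter> slab h \<xi>)"
  shows "P = Q"
proof -
  define H where "H t = h (circle_point t)" for t
  have sph: "circle_point t \<in> sphere 0 1" for t using circle_point_sphere by blast
  have H: "extends_holomorphically H"
    using assms(5) unfolding analytic_hedgehog_def H_def by (rule real_analytic_imp_extends_holomorphically)
  have per: "H (t + pi) = H t" for t
    using assms(6) sph unfolding H_def origin_symmetric_hedgehog_def circle_point_add_pi by simp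
  have hh: "hedgehog h = contact_point H ` {0..2 * pi}"
    unfolding hedgehog_def contact_point_def H_def by simp
  \<comment> \<open>the hedgehog is parametrised by one period only, so the angle is reduced modulo \<open>2\<pi>\<close>\<close>
  have env: "contact_point H t \<in> hedgehog h" for t
  proof -
    obtain t' where t': "t' \<in> {0..2 * pi}" "circle_point t' = circle_point t" "circle_normal t' = circle_normal t"
    proof -
      have "(cos t)\<^sup>2 + (sin t)\<^sup>2 = 1" by simp
      then obtain t' where "0 \<le> t'" "t' < 2 * pi" "cos t = cos t'" "sin t = sin t'"
        using sincos_total_2pi by metis
      then show ?thesis using that[of t'] by (simp add: circle_point_def circle_normal_def)
    qed
    have shift: "H (u + (t' - t)) = H u" for u
    proof -
      have "cos (t' - t) = 1" "sin (t' - t) = 0"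
        using t'(2) circle_inner(1)[of t' t] circle_inner(2)[of t t'] t'(2) circle_inner(1)[of t t] circle_inner(2)[of t t] by auto
      then have "circle_point (u + (t' - t)) = circle_point u"
        by (simp add: circle_point_def cos_add sin_add)
      then show ?thesis by (simp add: H_def)
    qed
    have "((\<lambda>u. H (u + (t' - t))) has_real_derivative deriv H (t + (t' - t))) (at t)"
      using extends_holomorphically_has_derivative[OF H, of "t + (t' - t)"] by (subst DERIV_shift[symmetric]) simp
    then have "deriv H t' = deriv H t"
      using extends_holomorphically_has_derivative[OF H, of t] unfolding shift by (simp add: DERIV_unique)
    then have "contact_point H t' = contact_point H t" using t' shift[of t] by (simp add: contact_point_def)
    then show ?thesis using t'(1) unfolding hh by (metis imageI)
  qed
  obtain t\<^sub>0 where nz: "H t\<^sub>0 \<noteq> 0"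
  proof (rule ccontr)
    assume "\<not> thesis"
    then have "H = (\<lambda>_. 0)" using that by blast
    then have "hedgehog h = {0}" unfolding hh contact_point_def by (simp add: image_constant_conv)
    then show False using assms(7) unfolding nontrivial_hedgehog_def by blast
  qed
  have slab: "slab h (circle_point t) = {x. \<bar>x \<bullet> circle_point t\<bar> \<le> \<bar>H t\<bar>}" for t
    unfolding H_def by (rule slab_origin_symmetric[OF assms(6) sph])
  have "measure lebesgue (P \<inter> {x. \<bar>x \<bullet> circle_point t\<bar> \<le> \<bar>H t\<bar>}) =
      measure lebesgue (Q \<inter> {x. \<bar>x \<bullet> circle_point t\<bar> \<le> \<bar>H t\<bar>})" for t
    using assms(10)[OF sph, of t] unfolding slab .
  then show ?thesis
    using polygon_subset[OF assms(1-4) H per nz] polygon_subset[OF assms(3,4,1,2) H per nz]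
      env assms(8,9) by (intro equalityI) (auto simp: subset_iff)
qed

end
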